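(* Let $A,h,u,\Gamma,f,g,\Phi,\Lambda,p,W,\mathcal{C}$ be as described in the context (in particular $h\in\mathcal{C}\cap L^1[0,\infty)$ and $\Lambda$ is singular, so $p\ge1$), and assume the following. (1) There exists a positive constant $K$ such that $\|\Phi(t)\Phi^{-1}(s)\|\le K$ for all $t\ge s\ge 0$. (2) $\frac{\partial g}{\partial x}$ is uniformly continuous on $[0,\infty)\times\mathbb{R}^n$ and $\int_0^\infty\left\|\frac{\partial g}{\partial x}(t,0)\right\|dt<\infty$. (3) For all $\eta\in\mathcal{C}$, $\int_0^\infty|g(t,\eta(t))|\,dt<\infty$. (4) $\frac{\partial f}{\partial x}$ is uniformly continuous on $[0,\infty)\times\mathbb{R}^n$ and $\int_0^\infty\left\|\frac{\partial f}{\partial x}(t,0)\right\|dt<\infty$. (5) There exists $s\in L^1[0,\infty)$ such that $\left\|\frac{\partial g}{\partial x}(t,x_1)-\frac{\partial g}{\partial x}(t,x_2)\right\|\le s(t)|x_1-x_2|$ for all $t\ge0$ and $x_1,x_2\in\mathbb{R}^n$. (6) There exists $h_1\in L^1[0,\infty)$ such that for every compact subset $S$ of $\mathbb{R}^n$ there exists a constant $C$ with $|f(t,x)|\le Ch_1(t)$ for all $t\ge0$ and $x\in S$, and $|f(t,x_1)-f(t,x_2)|\le h_1(t)|x_1-x_2|$ for all $x_1,x_2\in S$ and $t\ge0$. (7) There exists $h_2\in L^1[0,\infty)$ such that for any compact subset $S\subset\mathbb{R}^n$, $\left\|\frac{\partial f}{\partial x}(t,x_1)-\frac{\partial f}{\partial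 x}(t,x_2)\right\|\le h_2(t)|x_1-x_2|$ for all $t\ge0$ and $x_1,x_2\in S$. For $y\in\mathbb{R}^n$ write $x_y(t)=\Phi(t)y+\Phi(t)\int_0^t\Phi^{-1}(s)h(s)\,ds$. Suppose there exists $y\in\ker(\Lambda)$ such that $$W^T\left[\int_0^\infty g(t,x_y(t))\,dt-\Gamma\left(\Phi(\cdot)\int_0^{\cdot}\Phi^{-1}(s)f(s,x_y(s))\,ds\right)\right]=0$$ and such that the map $\phi:\ker(\Lambda)\to\mathbb{R}^p$ defined by $$\phi(w)=W^T\left[\int_0^\infty\frac{\partial g}{\partial x}(t,x_y(t))\Phi(t)\,dt-\Gamma\left(\Phi(\cdot)\int_0^{\cdot}\Phi^{-1}(s)\frac{\partial f}{\partial x}(s,x_y(s))\Phi(s)\,ds\right)\right]w$$ is a bijection from $\ker(\Lambda)\subset\mathbb{R}^n$ onto $\mathbb{R}^p$. Then there exists $\varepsilon_0>0$ such that for all $|\varepsilon|\le\varepsilon_0$ the boundary value problem $$x'(t)-A(t)x(t)=h(t)+\varepsilon f(t,x(t)),\qquad \Gamma(x)=u+\varepsilon\int_0^\infty g(t,x(t))\,dt$$ on $[0,\infty)$ is guaranteed a solution $x_\varepsilon$. Moreover $\|x_\varepsilon-x_y\|_\infty\to 0$ as $\varepsilon\to 0$.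
   Context: $\mathcal{C}$ is the Banach space of bounded continuous functions from $[0,\infty)$ into $\mathbb{R}^n$ with norm $\|x\|_\infty=\sup_{t\ge0}|x(t)|$, where $|\cdot|$ is the Euclidean norm; $\|\cdot\|$ is the operator norm on $n\times n$ real matrices. $A$ is a continuous $n\times n$ real matrix-valued function on $[0,\infty)$; $h\in\mathcal{C}\cap L^1[0,\infty)$; $u\in\mathbb{R}^n$; $f,g:\mathbb{R}^{n+1}=\mathbb{R}\times\mathbb{R}^n\to\mathbb{R}^n$ are continuously differentiable maps of $(t,x)$, and $\frac{\partial f}{\partial x},\frac{\partial g}{\partial x}$ denote the Jacobian matrices in the variable $x\in\mathbb{R}^n$; $\Gamma:\mathcal{C}\to\mathbb{R}^n$ is a bounded linear map. When $\Gamma$ is applied to a matrix-valued function, it is applied columnwise, giving a matrix. $\Phi(t)$ is the fundamental matrix for $x'(t)-A(t)x(t)=0$ with $\Phi(0)=I$, and $\Phi_i$ is its $i$th column. $\Lambda$ is the $n\times n$ matrix $[\Gamma(\Phi_1(\cdot))\,|\,\cdots\,|\,\Gamma(\Phi_n(\cdot))]$. (The columns $\Phi_i$ lie in $\mathcal{C}$ by hypothesis (1).) $p$ is the dimension of $\ker(\Lambda)$, and $\Lambda$ is assumed singular, so $p\ge1$. $W$ is an $n\times p$ matrix whose columns form a basis of $\ker(\Lambda^T)$. Standing assumption: $h$ and $u$ are such that the linear problem $x'(t)-A(t)x(t)=h(t)$, $\Gamma(x)=u$ has a solution, equivalently $W^T\left[u-\Gamma\left(\Phi(\cdot)\int_0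^{\cdot}\Phi^{-1}(s)h(s)\,ds\right)\right]=0$.
   Formalization: As written the claim fails when u differs from Γ(Φ∫Φ⁻¹h), since then Γ(x_y)≠u. The formal version takes x_y=Φ(v+y)+Φ∫Φ⁻¹h with y∈ker Λ, where v is the initial value of a solution of the linear problem; v=0 recovers the original. *)

theory Defs
  imports "HOL-Analysis.Analysis"
begin

(* Functions on [0,\<infinity>) are represented by functions on all reals; only their values on
   {0..} matter.  BC is the space of bounded continuous functions on [0,\<infinity>). *)

definition BC :: "(real \<Rightarrow> real^'n) set" where
  "BC = {x. continuous_on {0..} x \<and> bounded (x ` {0..})}"

definition sup_norm :: "(real \<Rightarrow> real^'n) \<Rightarrow> real" where
  "sup_norm x = (SUP t\<in>{0..}. norm (x t))"

(* The norm bound together with linearity makes \<Gamma> x depend only on x restricted to {0..}: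
   if x and y agree there, then x - y has sup_norm 0. *)

definition bounded_linear_BC :: "((real \<Rightarrow> real^'n) \<Rightarrow> real^'n) \<Rightarrow> bool" where
  "bounded_linear_BC \<Gamma> \<longleftrightarrow>
     (\<forall>x\<in>BC. \<forall>y\<in>BC. \<Gamma> (\<lambda>t. x t + y t) = \<Gamma> x + \<Gamma> y) \<and>
     (\<forall>c. \<forall>x\<in>BC. \<Gamma> (\<lambda>t. c *\<^sub>R x t) = c *\<^sub>R \<Gamma> x) \<and>
     (\<exists>B. \<forall>x\<in>BC. norm (\<Gamma> x) \<le> B * sup_norm x)"

definition columnwise :: "((real \<Rightarrow> real^'n) \<Rightarrow> real^'n) \<Rightarrow> (real \<Rightarrow> real^'n^'n) \<Rightarrow> real^'n^'n" where
  "columnwise \<Gamma> M = (\<chi> i j. \<Gamma> (\<lambda>t. column j (M t)) $ i)"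

definition op_norm :: "real^'n^'n \<Rightarrow> real" where
  "op_norm M = onorm ((*v) M)"

definition matrix_ker :: "real^'n^'m \<Rightarrow> (real^'n) set" where
  "matrix_ker M = {v. M *v v = 0}"

definition C1_map :: "(real \<times> (real^'n) \<Rightarrow> real^'n) \<Rightarrow> bool" where
  "C1_map F \<longleftrightarrow>
     (\<exists>F'. (\<forall>z. (F has_derivative blinfun_apply (F' z)) (at z)) \<and> continuous_on UNIV F')"

(* The Jacobian of F in its second argument. *)

definition jac_x :: "(real \<times> (real^'n) \<Rightarrow> real^'n) \<Rightarrow> real \<Rightarrow> real^'n \<Rightarrow> real^'n^'n" where
  "jac_x F t x = jacobian (\<lambda>z. F (t, z)) (at x)"

(* L^1[0,\<infinity>) and finiteness of integrals over [0,\<infinity>) are expressed with the library's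
   absolutely_integrable_on, i.e. Lebesgue integrability; on such functions the
   gauge integral used below equals the Lebesgue integral. *)

definition fundamental_matrix :: "(real \<Rightarrow> real^'n^'n) \<Rightarrow> (real \<Rightarrow> real^'n^'n) \<Rightarrow> bool" where
  "fundamental_matrix A \<Phi> \<longleftrightarrow>
     \<Phi> 0 = mat 1 \<and>
     (\<forall>t\<ge>0. (\<Phi> has_vector_derivative A t ** \<Phi> t) (at t within {0..}))"

definition duhamel :: "(real \<Rightarrow> real^'n^'n) \<Rightarrow> (real \<Rightarrow> real^'n) \<Rightarrow> real \<Rightarrow> real^'n" where
  "duhamel \<Phi> q t = \<Phi> t *v integral {0..t} (\<lambda>s. matrix_inv (\<Phi> s) *v q s)"

definition duhamel_matrix ::
    "(real \<Rightarrow> real^'n^'n) \<Rightarrow> (real \<Rightarrow> real^'n^'n) \<Rightarrow> real \<Rightarrow> real^'n^'n" where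
  "duhamel_matrix \<Phi> Q t = \<Phi> t ** integral {0..t} (\<lambda>s. matrix_inv (\<Phi> s) ** Q s)"

(* The solution of x' - A x = h with x(0) = b. *)

definition linear_trajectory ::
    "(real \<Rightarrow> real^'n^'n) \<Rightarrow> (real \<Rightarrow> real^'n) \<Rightarrow> real^'n \<Rightarrow> real \<Rightarrow> real^'n" where
  "linear_trajectory \<Phi> h b t = \<Phi> t *v b + duhamel \<Phi> h t"

(* x in BC solves x'(t) - A(t) x(t) = q(t) on [0,\<infinity>), \<Gamma> x = b. *)

definition solves_bvp ::
    "(real \<Rightarrow> real^'n^'n) \<Rightarrow> ((real \<Rightarrow> real^'n) \<Rightarrow> real^'n) \<Rightarrow>
     (real \<Rightarrow> real^'n) \<Rightarrow> real^'n \<Rightarrow> (real \<Rightarrow> real^'n) \<Rightarrow> bool" where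
  "solves_bvp A \<Gamma> q b x \<longleftrightarrow>
     x \<in> BC \<and>
     (\<forall>t\<ge>0. \<exists>x'. (x has_vector_derivative x') (at t within {0..}) \<and> x' - A t *v x t = q t) \<and>
     \<Gamma> x = b"

(* If linear_trajectory \<Phi> h v solves the linear problem x' - A x = h, \<Gamma> x = u, then all its
   solutions are linear_trajectory \<Phi> h (v + y) with y in the kernel of
   \<Lambda> = columnwise \<Gamma> \<Phi>.  The offset v can be taken to be 0 exactly when
   \<Gamma> (duhamel \<Phi> h) = u; otherwise it cannot be dropped: for y in the kernel,
   linear_trajectory \<Phi> h y then misses the boundary condition and cannot be a limit of
   solutions of the perturbed problems. *)

end

theory Submission
  imports Defs
begin

text \<open>By variation of constants, \<open>x\<close> solves the perturbed problem iff
  \<open>x = xy + \<Phi> z + \<epsilon> duhamel \<Phi> f(\<cdot>, x)\<close> for some \<open>z\<close> with \<open>\<Lambda> z = \<epsilon> N x\<close>, where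
  \<open>N x = \<integral> g(t, x t) dt - \<Gamma> (duhamel \<Phi> f(\<cdot>, x))\<close>.  The \<open>L\<^sup>1\<close> Lipschitz bounds on the
  Jacobians make \<open>N\<close> strictly differentiable at \<open>xy\<close> in the sup norm, its derivative composed with
  \<open>w \<mapsto> \<Phi> w\<close> and followed by \<open>W\<^sup>T\<close> is the map \<open>\<phi>\<close>, and the kernel of \<open>W\<^sup>T\<close> is the
  range of \<open>\<Lambda>\<close>.  Hence the system is a Lyapunov--Schmidt problem for \<open>(x, z)\<close>.\<close>

subsection \<open>Lyapunov--Schmidt reduction\<close>

text \<open>The obstacle is that \<Lambda> is singular: at \<epsilon> = 0 the equation for
  \<open>z\<close> only says that \<open>z\<close> lies in its kernel, so the kernel component of
  \<open>x\<close> is free and no implicit function argument applies directly. For \<epsilon>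
  \<noteq> 0 the same equation hides the condition that \<open>N x\<close> lies in the range of
  \<Lambda>, that is, \<open>W\<^sup>T (N x) = 0\<close>. This condition survives the limit, holds
  at \<open>xy\<close> by hypothesis, and bijectivity of \<phi> is the nondegeneracy that lets it
  determine the kernel component. Strict differentiability at the single point \<open>xy\<close>
  suffices: the derivative is frozen there, and the remainder estimate for two nearby arguments
  makes the Newton map a contraction with constants uniform in \<epsilon>. Convergence comes from
  the start point being displaced by O(\<epsilon>), not from any regularity of the solutions in
  \<epsilon>. The vector \<open>z\<close> is tracked by evaluation at time 0, since \<Phi>(0) = I
  and Duhamel terms vanish there.\<close>

lemma perturbed_fixed_points:
  fixes S :: "real \<Rightarrow> 'e::{real_normed_vector, complete_space} \<Rightarrow> 'e"
  assumes "\<rho> > 0" "\<epsilon>1 > 0" "C \<ge> 0"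
    and contr: "\<And>\<epsilon> x x'. \<lbrakk>\<bar>\<epsilon>\<bar> \<le> \<epsilon>1; x \<in> cball x0 \<rho>; x' \<in> cball x0 \<rho>\<rbrakk>
                  \<Longrightarrow> norm (S \<epsilon> x - S \<epsilon> x') \<le> norm (x - x') / 2"
    and start: "\<And>\<epsilon>. \<bar>\<epsilon>\<bar> \<le> \<epsilon>1 \<Longrightarrow> norm (S \<epsilon> x0 - x0) \<le> C * \<bar>\<epsilon>\<bar>"
  obtains \<epsilon>0 X where "\<epsilon>0 > 0" "\<epsilon>0 \<le> \<epsilon>1"
    "\<And>\<epsilon>. \<bar>\<epsilon>\<bar> \<le> \<epsilon>0 \<Longrightarrow> X \<epsilon> \<in> cball x0 \<rho> \<and> S \<epsilon> (X \<epsilon>) = X \<epsilon>"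
    "(X \<longlongrightarrow> x0) (at 0)"
proof -
  \<comment> \<open>The start point may move by half the radius, and the contraction uses the other
    half; \<open>C + 1\<close> keeps the quotient meaningful when \<open>C\<close> is 0.\<close>
  define \<epsilon>0 where "\<epsilon>0 = min \<epsilon>1 (\<rho> / (2 * (C + 1)))"
  have e0: "\<epsilon>0 > 0" "\<epsilon>0 \<le> \<epsilon>1" using assms by (auto simp: \<epsilon>0_def)
  have start': "norm (S \<epsilon> x0 - x0) \<le> \<rho> / 2" if "\<bar>\<epsilon>\<bar> \<le> \<epsilon>0" for \<epsilon>
  proof -
    have "norm (S \<epsilon> x0 - x0) \<le> C * \<bar>\<epsilon>\<bar>" using start that e0 by auto
    also have "\<dots> \<le> (C + 1) * (\<rho> / (2 * (C + 1)))"
      using that assms by (intro mult_mono) (auto simp: \<epsilon>0_def)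
    also have "\<dots> = \<rho> / 2" using assms by (simp add: field_simps)
    finally show ?thesis .
  qed
  have "\<exists>x\<in>cball x0 \<rho>. S \<epsilon> x = x" if e: "\<bar>\<epsilon>\<bar> \<le> \<epsilon>0" for \<epsilon>
  proof -
    have "S \<epsilon> x \<in> cball x0 \<rho>" if x: "x \<in> cball x0 \<rho>" for x
    proof -
      have "norm (S \<epsilon> x - x0) \<le> norm (S \<epsilon> x - S \<epsilon> x0) + norm (S \<epsilon> x0 - x0)"
        by (metis norm_triangle_ineq diff_add_cancel add_diff_eq)
      also have "norm (S \<epsilon> x - S \<epsilon> x0) \<le> norm (x - x0) / 2"
        using contr[of \<epsilon> x x0] e e0 x assms by auto
      also have "norm (x - x0) \<le> \<rho>" using x by (simp add: dist_norm norm_minus_commute)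
      finally show ?thesis using start'[OF e] by (simp add: dist_norm norm_minus_commute)
    qed
    moreover have "dist (S \<epsilon> x) (S \<epsilon> x') \<le> (1/2) * dist x x'"
      if "x \<in> cball x0 \<rho>" "x' \<in> cball x0 \<rho>" for x x'
      using contr[of \<epsilon> x x'] that e e0 by (simp add: dist_norm)
    ultimately have "\<exists>!x\<in>cball x0 \<rho>. S \<epsilon> x = x"
      using assms by (intro Banach_fix[where c = "1/2"]) (auto simp: complete_eq_closed)
    then show ?thesis by blast
  qed
  then obtain X where X: "\<And>\<epsilon>. \<bar>\<epsilon>\<bar> \<le> \<epsilon>0 \<Longrightarrow> X \<epsilon> \<in> cball x0 \<rho> \<and> S \<epsilon> (X \<epsilon>) = X \<epsilon>"
    by metis
  \<comment> \<open>The contraction absorbs half of the distance to \<open>x0\<close>, so that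
    distance is at most twice the initial displacement. The limit follows from this rate without
    continuity of \<open>X\<close>.\<close>
  have bound: "norm (X \<epsilon> - x0) \<le> 2 * C * \<bar>\<epsilon>\<bar>" if e: "\<bar>\<epsilon>\<bar> \<le> \<epsilon>0" for \<epsilon>
  proof -
    have "norm (X \<epsilon> - x0) \<le> norm (S \<epsilon> (X \<epsilon>) - S \<epsilon> x0) + norm (S \<epsilon> x0 - x0)"
      using X[OF e] by (metis norm_triangle_ineq diff_add_cancel add_diff_eq)
    also have "norm (S \<epsilon> (X \<epsilon>) - S \<epsilon> x0) \<le> norm (X \<epsilon> - x0) / 2"
      using contr[of \<epsilon> "X \<epsilon>" x0] X[OF e] e e0 assms by auto
    also have "norm (S \<epsilon> x0 - x0) \<le> C * \<bar>\<epsilon>\<bar>" using start e e0 by auto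
    finally show ?thesis by simp
  qed
  have "((\<lambda>\<epsilon>. X \<epsilon> - x0) \<longlongrightarrow> 0) (at 0)"
  proof (rule Lim_null_comparison)
    show "\<forall>\<^sub>F \<epsilon> in at 0. norm (X \<epsilon> - x0) \<le> 2 * C * \<bar>\<epsilon>\<bar>"
      unfolding eventually_at using e0 bound by (intro exI[of _ \<epsilon>0]) auto
    show "((\<lambda>\<epsilon>. 2 * C * \<bar>\<epsilon>\<bar>) \<longlongrightarrow> 0) (at 0)"
      by (auto intro!: tendsto_eq_intros)
  qed
  then have "(X \<longlongrightarrow> x0) (at 0)" by (simp add: LIM_zero_iff)
  with e0 X that show ?thesis by blast
qed

text \<open>A right inverse \<open>T0\<close> on the range satisfies \<open>F T0 F = F\<close>;
  passing to \<open>T0 F T0\<close> adds the identity \<open>T F T = T\<close>, valid at every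
  \<open>r\<close>. This second identity allows \<open>T\<close> to be applied to \<open>N x\<close>
  before \<open>N x\<close> is known to lie in the range.\<close>

lemma reflexive_generalized_inverse:
  fixes F :: "'a::euclidean_space \<Rightarrow> 'b::euclidean_space"
  assumes "linear F"
  obtains T where "linear T" "\<And>r. r \<in> range F \<Longrightarrow> F (T r) = r" "\<And>r. T (F (T r)) = T r"
proof -
  obtain T0 where T0: "linear T0" "\<forall>r\<in>range F. F (T0 r) = r"
    using linear_exists_right_inverse_on[OF assms subspace_UNIV] by blast
  show ?thesis
  proof (rule that[of "\<lambda>r. T0 (F (T0 r))"])
    show "linear (\<lambda>r. T0 (F (T0 r)))"
      using linear_compose[OF linear_compose[OF T0(1) assms] T0(1)] by (simp add: o_def)
  qed (use T0 in auto)
qed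

text \<open>Lyapunov--Schmidt reduction written as one contraction on the Banach space.  With
  \<open>P = I - T Lam\<close>, \<open>p x = P (ev (x - x0))\<close> and \<open>Q x = J (T (N x)) + D x\<close>, a Newton step in the
  kernel direction is applied to \<open>x0 + J (p x) + \<epsilon> Q x\<close>.  At \<open>\<epsilon> = 0\<close> the map depends on \<open>x\<close>
  only through \<open>p x\<close>, and the Newton step cancels that dependence to first order.\<close>

theorem lyapunov_schmidt:
  fixes N L :: "'e::{real_normed_vector, complete_space} \<Rightarrow> 'b::euclidean_space" and D :: "'e \<Rightarrow> 'e"
    and J :: "'a::euclidean_space \<Rightarrow> 'e" and ev :: "'e \<Rightarrow> 'a"
    and Lam :: "'a \<Rightarrow> 'b" and W :: "'b \<Rightarrow> 'c::euclidean_space"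
  assumes J: "bounded_linear J" and ev: "bounded_linear ev" and L: "bounded_linear L"
    and Lam: "linear Lam" and W: "linear W"
    and ev_J: "\<And>z. ev (J z) = z" and ev_D: "\<And>x. ev (D x) = 0"
    and ker_W: "{r. W r = 0} = range Lam"
    and zero: "W (N x0) = 0"
    and N: "\<And>e. e > 0 \<Longrightarrow> \<exists>\<delta>>0. \<forall>x\<in>cball x0 \<delta>. \<forall>x'\<in>cball x0 \<delta>.
              norm (N x - N x' - L (x - x')) \<le> e * norm (x - x')"
    and D: "r > 0" "\<And>x x'. \<lbrakk>x \<in> cball x0 r; x' \<in> cball x0 r\<rbrakk>
              \<Longrightarrow> norm (D x - D x') \<le> C * norm (x - x')"
    and bij: "bij_betw (\<lambda>z. W (L (J z))) {z. Lam z = 0} UNIV"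
  obtains \<epsilon>0 X where "\<epsilon>0 > 0"
    "\<And>\<epsilon>. \<bar>\<epsilon>\<bar> \<le> \<epsilon>0 \<Longrightarrow> \<exists>z. X \<epsilon> = x0 + J z + \<epsilon> *\<^sub>R D (X \<epsilon>) \<and> Lam z = \<epsilon> *\<^sub>R N (X \<epsilon>)"
    "(X \<longlongrightarrow> x0) (at 0)"
proof -
  interpret J: bounded_linear J by fact
  interpret ev: bounded_linear ev by fact
  interpret L: bounded_linear L by fact
  obtain T where T: "linear T" "\<And>r. r \<in> range Lam \<Longrightarrow> Lam (T r) = r" "\<And>r. T (Lam (T r)) = T r"
    using reflexive_generalized_inverse[OF Lam] by metis
  have lin_phi: "linear (\<lambda>z. W (L (J z)))"
    using linear_compose[OF linear_compose[OF J.linear L.linear] W] by (simp add: o_def)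
  have "subspace {z. Lam z = 0}" by (rule linear_subspace_kernel[OF Lam])
  \<comment> \<open>Restricting to the kernel of \<open>Lam\<close> makes \<open>M\<close> take
    values there. Bijectivity turns it into a two-sided inverse of \<phi>, bounded because it is
    linear on a finite-dimensional space.\<close>
  from linear_exists_right_inverse_on[OF lin_phi this]
  obtain M where M: "range M \<subseteq> {z. Lam z = 0}" "linear M"
    "\<forall>v\<in>(\<lambda>z. W (L (J z))) ` {z. Lam z = 0}. W (L (J (M v))) = v" by auto
  have phi_M: "W (L (J (M v))) = v" for v
  proof -
    have "v \<in> (\<lambda>z. W (L (J z))) ` {z. Lam z = 0}" using bij by (simp add: bij_betw_def)
    then show ?thesis using M(3) by blast
  qed
  have Lam_M: "Lam (M v) = 0" for v using M(1) by blast
  have M_phi: "M (W (L (J z))) = z" if "Lam z = 0" for z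
    using bij phi_M Lam_M that unfolding bij_betw_def inj_on_def by blast
  define p where "p = (\<lambda>d. ev d - T (Lam (ev d)))"
  \<comment> \<open>The Newton correction: the inverse of the derivative frozen at
    \<open>x0\<close>, applied to the residual \<open>W b\<close> and embedded through
    \<open>J\<close>.\<close>
  define m where "m = (\<lambda>b. J (M (W b)))"
  have bl_p: "bounded_linear (\<lambda>d. J (p d))"
    unfolding p_def using ev
    by (intro bounded_linear_compose[OF J] bounded_linear_sub
          bounded_linear_compose[OF linear_conv_bounded_linear[THEN iffD1, OF T(1)]]
          bounded_linear_compose[OF linear_conv_bounded_linear[THEN iffD1, OF Lam]])
  interpret p: bounded_linear "\<lambda>d. J (p d)" by fact
  have bl_m: "bounded_linear m"
    unfolding m_def
    by (intro bounded_linear_compose[OF J]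
          bounded_linear_compose[OF linear_conv_bounded_linear[THEN iffD1, OF M(2)]]
          linear_conv_bounded_linear[THEN iffD1, OF W])
  interpret m: bounded_linear m by fact
  have bl_T: "bounded_linear (\<lambda>b. J (T b))"
    by (intro bounded_linear_compose[OF J] linear_conv_bounded_linear[THEN iffD1, OF T(1)])
  interpret T: bounded_linear "\<lambda>b. J (T b)" by fact
  have T_inv: "Lam (T (Lam z)) = Lam z" for z using T(2) by blast
  have Lam_p: "Lam (p d) = 0" for d
    unfolding p_def by (simp add: linear_diff[OF Lam] T_inv)
  \<comment> \<open>On the embedded kernel \<open>m\<close> inverts \<open>L\<close>; this removes
    the first-order dependence on \<open>p\<close> in the contraction estimate.\<close>
  have m_L_p: "m (L (J (p d))) = J (p d)" for d
    unfolding m_def using M_phi[OF Lam_p] by simp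

  obtain kP where kP: "kP > 0" "\<And>d. norm (J (p d)) \<le> norm d * kP" using p.pos_bounded by blast
  obtain kM where kM: "kM > 0" "\<And>d. norm (m d) \<le> norm d * kM" using m.pos_bounded by blast
  obtain kT where kT: "kT > 0" "\<And>d. norm (J (T d)) \<le> norm d * kT" using T.pos_bounded by blast
  obtain kL where kL: "kL > 0" "\<And>d. norm (L d) \<le> norm d * kL" using L.pos_bounded by blast
  \<comment> \<open>\<open>kP + 1\<close> will bound the Lipschitz constant of the inner argument of
    \<open>S\<close>, and \<open>kM\<close> bounds the Newton correction, so the error of strict
    differentiability contributes \<open>e * c = 1/4\<close>. The terms with a factor \<epsilon> get
    the other quarter.\<close>
  define c where "c = (kP + 1) * kM"
  have c: "c > 0" using kM kP by (simp add: c_def)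
  define e where "e = 1 / (4 * c)"
  have e: "e > 0" using c by (simp add: e_def)
  obtain \<delta> where \<delta>: "\<delta> > 0" "\<And>x x'. \<lbrakk>x \<in> cball x0 \<delta>; x' \<in> cball x0 \<delta>\<rbrakk> \<Longrightarrow>
     norm (N x - N x' - L (x - x')) \<le> e * norm (x - x')"
    using N[OF e] by blast
  have N_lip: "norm (N x - N x') \<le> (kL + e) * norm (x - x')"
    if "x \<in> cball x0 \<delta>" "x' \<in> cball x0 \<delta>" for x x'
  proof -
    have "norm (N x - N x') \<le> norm (N x - N x' - L (x - x')) + norm (L (x - x'))"
      by (metis norm_triangle_ineq diff_add_cancel)
    then show ?thesis using \<delta>(2)[OF that] kL(2)[of "x - x'"] by (simp add: algebra_simps)
  qed

  define Q where "Q = (\<lambda>x. J (T (N x)) + D x)"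
  define CQ where "CQ = (kL + e) * kT + \<bar>C\<bar>"
  have CQ: "CQ \<ge> 0" using kL kT e by (simp add: CQ_def)
  define r1 where "r1 = min r \<delta>"
  have r1: "r1 > 0" using D \<delta> by (simp add: r1_def)
  have Q_lip: "norm (Q x - Q x') \<le> CQ * norm (x - x')"
    if "x \<in> cball x0 r1" "x' \<in> cball x0 r1" for x x'
  proof -
    have "Q x - Q x' = J (T (N x - N x')) + (D x - D x')"
      by (simp add: Q_def T.diff)
    then have "norm (Q x - Q x') \<le> norm (J (T (N x - N x'))) + norm (D x - D x')"
      by (simp add: norm_triangle_ineq)
    also have "\<dots> \<le> norm (N x - N x') * kT + C * norm (x - x')"
      using kT(2) D(2) that by (intro add_mono) (auto simp: r1_def)
    also have "\<dots> \<le> ((kL + e) * norm (x - x')) * kT + \<bar>C\<bar> * norm (x - x')"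
      using N_lip[of x x'] that kT by (intro add_mono mult_right_mono) (auto simp: r1_def)
    finally show ?thesis by (simp add: CQ_def algebra_simps)
  qed
  define BQ where "BQ = norm (Q x0) + CQ * r1"
  have BQ: "norm (Q x) \<le> BQ" if "x \<in> cball x0 r1" for x
  proof -
    have "norm (Q x) \<le> norm (Q x0) + norm (Q x - Q x0)"
      using norm_triangle_sub by blast
    also have "norm (Q x - Q x0) \<le> CQ * norm (x - x0)" using Q_lip that r1 by auto
    also have "\<dots> \<le> CQ * r1" using that CQ
      by (intro mult_left_mono) (auto simp: dist_norm norm_minus_commute)
    finally show ?thesis by (simp add: BQ_def)
  qed
  have BQ0: "BQ \<ge> 0" using order_trans[OF norm_ge_zero BQ[of x0]] r1 by simp

  \<comment> \<open>The kernel part of the inner argument takes half of \<delta>, its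
    \<epsilon>-part the other half, so \<open>N\<close> is only evaluated where its remainder is
    controlled.\<close>
  define \<rho> where "\<rho> = min r1 (\<delta> / (2 * kP))"
  have \<rho>: "\<rho> > 0" "\<rho> \<le> r1" "kP * \<rho> \<le> \<delta> / 2"
    using r1 \<delta> kP by (auto simp: \<rho>_def field_simps min_def)
  define u where "u = kM * kL + 1"
  have u: "u > 0" unfolding u_def using kM kL by (intro add_pos_pos mult_pos_pos) auto
  \<comment> \<open>The three bounds serve, in order, to keep the inner argument in the
    \<delta>-ball, to make its \<epsilon>-part 1-Lipschitz, and to limit that part together with its
    Newton correction to a quarter.\<close>
  define \<epsilon>1 where "\<epsilon>1 = min (\<delta> / (2 * (BQ + 1))) (min (1 / (CQ + 1)) (1 / (4 * (u * (CQ + 1)))))"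
  have \<epsilon>1: "\<epsilon>1 > 0" unfolding \<epsilon>1_def using \<delta> BQ0 CQ u by (auto intro!: divide_pos_pos mult_pos_pos add_nonneg_pos)
  have small: "\<bar>\<epsilon>\<bar> * BQ \<le> \<delta> / 2" "\<bar>\<epsilon>\<bar> * CQ \<le> 1" "\<bar>\<epsilon>\<bar> * (u * CQ) \<le> 1 / 4"
    if "\<bar>\<epsilon>\<bar> \<le> \<epsilon>1" for \<epsilon>
  proof -
    have cancel: "a / (k * b) * b = a / k" if "b > 0" for a b k :: real
      using that by simp
    have "\<bar>\<epsilon>\<bar> * BQ \<le> \<delta> / (2 * (BQ + 1)) * (BQ + 1)"
      using that BQ0 by (intro mult_mono) (auto simp: \<epsilon>1_def)
    also have "\<dots> = \<delta> / 2" using BQ0 cancel[of "BQ + 1" \<delta> 2] by simp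
    finally show "\<bar>\<epsilon>\<bar> * BQ \<le> \<delta> / 2" .
    have "\<bar>\<epsilon>\<bar> * CQ \<le> 1 / (CQ + 1) * (CQ + 1)"
      using that CQ by (intro mult_mono) (auto simp: \<epsilon>1_def)
    also have "\<dots> = 1" using CQ cancel[of "CQ + 1" 1 1] by simp
    finally show "\<bar>\<epsilon>\<bar> * CQ \<le> 1" .
    have "\<bar>\<epsilon>\<bar> * (u * CQ)
        \<le> 1 / (4 * (u * (CQ + 1))) * (u * (CQ + 1))"
      using that CQ u by (intro mult_mono) (auto simp: \<epsilon>1_def)
    also have "\<dots> = 1 / 4"
      using CQ u cancel[of "u * (CQ + 1)" 1 4] by simp
    finally show "\<bar>\<epsilon>\<bar> * (u * CQ) \<le> 1 / 4" .
  qed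

  define x' where "x' = (\<lambda>\<epsilon> x. x0 + J (p (x - x0)) + \<epsilon> *\<^sub>R Q x)"
  define S where "S = (\<lambda>\<epsilon> x. x' \<epsilon> x - m (N (x' \<epsilon> x)))"
  have x'_mem: "x' \<epsilon> x \<in> cball x0 \<delta>" if "\<bar>\<epsilon>\<bar> \<le> \<epsilon>1" "x \<in> cball x0 \<rho>" for \<epsilon> x
  proof -
    have "norm (x' \<epsilon> x - x0) \<le> norm (J (p (x - x0))) + norm (\<epsilon> *\<^sub>R Q x)"
      unfolding x'_def using norm_triangle_ineq[of "J (p (x - x0))" "\<epsilon> *\<^sub>R Q x"] by (simp add: add.assoc)
    also have "norm (J (p (x - x0))) \<le> norm (x - x0) * kP" by (rule kP)
    also have "norm (x - x0) * kP \<le> \<rho> * kP"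
      using that kP by (intro mult_right_mono) (auto simp: dist_norm norm_minus_commute)
    also have "norm (\<epsilon> *\<^sub>R Q x) \<le> \<bar>\<epsilon>\<bar> * BQ"
      using BQ[of x] that \<rho> by (auto intro!: mult_left_mono)
    finally show ?thesis using \<rho>(3) small(1)[OF that(1)] by (simp add: dist_norm norm_minus_commute mult.commute)
  qed
  have x'_diff: "x' \<epsilon> x - x' \<epsilon> z = J (p (x - z)) + \<epsilon> *\<^sub>R (Q x - Q z)" for \<epsilon> x z
    unfolding x'_def using p.diff[of "x - x0" "z - x0"] by (simp add: algebra_simps)
  have contr: "norm (S \<epsilon> x - S \<epsilon> z) \<le> norm (x - z) / 2"
    if eps: "\<bar>\<epsilon>\<bar> \<le> \<epsilon>1" and x: "x \<in> cball x0 \<rho>" and z: "z \<in> cball x0 \<rho>" for \<epsilon> x z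
  proof -
    define R where "R = N (x' \<epsilon> x) - N (x' \<epsilon> z) - L (x' \<epsilon> x - x' \<epsilon> z)"
    define q where "q = \<epsilon> *\<^sub>R (Q x - Q z)"
    have q: "norm q \<le> \<bar>\<epsilon>\<bar> * CQ * norm (x - z)"
      unfolding q_def using Q_lip[of x z] x z \<rho> by (auto intro!: mult_left_mono simp: mult.assoc)
    have "norm q \<le> 1 * norm (x - z)"
      using q small(2)[OF eps] by (meson mult_right_mono norm_ge_zero order_trans)
    then have "norm (x' \<epsilon> x - x' \<epsilon> z) \<le> norm (x - z) * kP + norm (x - z)"
      unfolding x'_diff q_def[symmetric] mult_1
      by (rule order_trans[OF norm_triangle_ineq add_mono[OF kP(2)]])
    then have "norm R \<le> e * (norm (x - z) * kP + norm (x - z))"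
      unfolding R_def using \<delta>(2)[OF x'_mem[OF eps x] x'_mem[OF eps z]] e
      by (meson less_imp_le mult_left_mono order_trans)
    then have "norm R * kM \<le> e * (norm (x - z) * kP + norm (x - z)) * kM"
      using kM by (intro mult_right_mono) auto
    also have "\<dots> = norm (x - z) * (e * c)" by (simp add: c_def algebra_simps)
    also have "e * c = 1 / 4" using c by (simp add: e_def)
    finally have R: "norm (m R) \<le> norm (x - z) / 4" using kM(2)[of R] by simp
    have "norm (m (L q)) \<le> norm q * kL * kM"
      using kM(2)[of "L q"] kL(2)[of q] kM(1) by (meson less_imp_le mult_right_mono order_trans)
    then have "norm q + norm (m (L q)) \<le> norm q * u" by (simp add: u_def algebra_simps)
    also have "\<dots> \<le> (\<bar>\<epsilon>\<bar> * CQ * norm (x - z)) * u"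
      using q u by (intro mult_right_mono) auto
    also have "\<dots> = (\<bar>\<epsilon>\<bar> * (u * CQ)) * norm (x - z)" by (simp add: algebra_simps)
    also have "\<dots> \<le> 1 / 4 * norm (x - z)" using small(3)[OF eps] by (intro mult_right_mono) auto
    finally have q': "norm q + norm (m (L q)) \<le> norm (x - z) / 4" by simp
    \<comment> \<open>Only \<open>J (p (x - z))\<close> carries no small factor. Since
      \<open>m L\<close> reproduces it exactly, it cancels against the same term in the difference
      of the inner arguments.\<close>
    have "N (x' \<epsilon> x) - N (x' \<epsilon> z) = R + L (J (p (x - z))) + L q"
      by (simp add: R_def x'_diff q_def L.add)
    then have "m (N (x' \<epsilon> x)) - m (N (x' \<epsilon> z)) = m R + J (p (x - z)) + m (L q)"
      by (simp add: m.diff[symmetric] m.add m_L_p)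
    then have "S \<epsilon> x - S \<epsilon> z = q - m (L q) - m R"
      unfolding S_def using x'_diff[of \<epsilon> x z] by (simp add: q_def algebra_simps)
    then have "norm (S \<epsilon> x - S \<epsilon> z) \<le> norm q + norm (m (L q)) + norm (m R)"
      using norm_triangle_ineq4[of "q - m (L q)" "m R"] norm_triangle_ineq4[of q "m (L q)"] by simp
    then show ?thesis using R q' by simp
  qed
  define C0 where "C0 = ((kL + e) * kM + 1) * norm (Q x0)"
  have C0: "C0 \<ge> 0" using kL kM e by (simp add: C0_def)
  have start: "norm (S \<epsilon> x0 - x0) \<le> C0 * \<bar>\<epsilon>\<bar>" if eps: "\<bar>\<epsilon>\<bar> \<le> \<epsilon>1" for \<epsilon>
  proof -
    have x'0: "x' \<epsilon> x0 = x0 + \<epsilon> *\<^sub>R Q x0" by (simp add: x'_def p.zero)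
    \<comment> \<open>The residual vanishes at \<open>x0\<close>, so \<open>x0\<close> is a fixed
      point for \<epsilon> = 0 and the displacement contains only terms of order \<epsilon>.\<close>
    have "m (N x0) = 0" unfolding m_def zero by (simp add: linear_0[OF M(2)] J.zero)
    then have "S \<epsilon> x0 - x0 = \<epsilon> *\<^sub>R Q x0 - m (N (x' \<epsilon> x0) - N x0)"
      unfolding S_def m.diff by (simp add: x'0)
    then have "norm (S \<epsilon> x0 - x0) \<le> norm (\<epsilon> *\<^sub>R Q x0) + norm (m (N (x' \<epsilon> x0) - N x0))"
      by (metis norm_triangle_ineq4)
    also have "norm (m (N (x' \<epsilon> x0) - N x0)) \<le> norm (N (x' \<epsilon> x0) - N x0) * kM" by (rule kM)
    also have "norm (N (x' \<epsilon> x0) - N x0) \<le> (kL + e) * norm (x' \<epsilon> x0 - x0)"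
      using N_lip[OF x'_mem[OF eps, of x0], of x0] \<rho> \<delta> by simp
    also have "norm (x' \<epsilon> x0 - x0) = \<bar>\<epsilon>\<bar> * norm (Q x0)" by (simp add: x'0)
    finally show ?thesis using kM by (simp add: C0_def algebra_simps)
  qed
  obtain \<epsilon>0 X where X: "\<epsilon>0 > 0" "\<epsilon>0 \<le> \<epsilon>1"
    "\<And>\<epsilon>. \<bar>\<epsilon>\<bar> \<le> \<epsilon>0 \<Longrightarrow> X \<epsilon> \<in> cball x0 \<rho> \<and> S \<epsilon> (X \<epsilon>) = X \<epsilon>" "(X \<longlongrightarrow> x0) (at 0)"
    using perturbed_fixed_points[OF \<rho>(1) \<epsilon>1 C0 contr start] by blast
  have "\<exists>z. X \<epsilon> = x0 + J z + \<epsilon> *\<^sub>R D (X \<epsilon>) \<and> Lam z = \<epsilon> *\<^sub>R N (X \<epsilon>)" if eps: "\<bar>\<epsilon>\<bar> \<le> \<epsilon>0" for \<epsilon>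
  proof -
    define x where "x = X \<epsilon>"
    define k where "k = M (W (N (x' \<epsilon> x)))"
    have fp: "x = x0 + J (p (x - x0)) + \<epsilon> *\<^sub>R Q x - J k"
      using X(3)[OF eps] by (simp add: x_def S_def k_def m_def x'_def)
    \<comment> \<open>A fixed point still carries the unknown correction \<open>k\<close>.
      Evaluating and projecting to the kernel shows that it vanishes: the projection annihilates the
      range of \<open>T\<close> and fixes \<open>p (x - x0)\<close> and \<open>k\<close>, so the
      equation becomes \<open>p (x - x0) = p (x - x0) - k\<close>.\<close>
    then have "ev (x - x0) = ev (J (p (x - x0)) + \<epsilon> *\<^sub>R Q x - J k)"
      by (metis (no_types, lifting) add.assoc add_diff_cancel_left' add_diff_eq)
    then have ev_x: "ev (x - x0) = p (x - x0) + \<epsilon> *\<^sub>R T (N x) - k"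
      by (simp add: ev.diff ev.add ev.scaleR Q_def ev_J ev_D)
    have Lam_k: "Lam k = 0" by (simp add: k_def Lam_M)
    have "Lam (ev (x - x0)) = \<epsilon> *\<^sub>R Lam (T (N x))"
      unfolding ev_x by (simp add: linear_diff[OF Lam] linear_add[OF Lam] linear_cmul[OF Lam] Lam_p Lam_k)
    then have "T (Lam (ev (x - x0))) = \<epsilon> *\<^sub>R T (N x)"
      by (simp add: linear_cmul[OF T(1)] T(3))
    then have "p (x - x0) = ev (x - x0) - \<epsilon> *\<^sub>R T (N x)" by (simp add: p_def)
    then have k0: "k = 0" using ev_x by simp
    then have x_eq: "x = x0 + J (p (x - x0)) + \<epsilon> *\<^sub>R Q x" using fp by (simp add: J.zero)
    then have "x' \<epsilon> x = x" by (simp add: x'_def)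
    \<comment> \<open>A vanishing correction means a vanishing residual, because
      \<open>W L J M\<close> is the identity; \<open>ker_W\<close> then puts \<open>N x\<close> in
      the range of \<open>Lam\<close>.\<close>
    then have "W (L (J (M (W (N x))))) = W (L (J 0))" using k0 by (simp add: k_def)
    then have "W (N x) = 0" unfolding phi_M by (simp add: J.zero L.zero linear_0[OF W])
    then have range: "N x \<in> range Lam" using ker_W by blast
    define z where "z = p (x - x0) + \<epsilon> *\<^sub>R T (N x)"
    have "x = x0 + J z + \<epsilon> *\<^sub>R D x"
      using x_eq by (simp add: z_def Q_def J.add J.scaleR scaleR_add_right add.assoc)
    moreover have "Lam z = \<epsilon> *\<^sub>R N x"
      by (simp add: z_def linear_add[OF Lam] linear_cmul[OF Lam] Lam_p T(2)[OF range])
    ultimately show ?thesis unfolding x_def by blast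
  qed
  with X that show ?thesis by blast
qed

subsection \<open>Matrices and linear systems\<close>

lemma norm_matrix_vector_le: "norm (M *v x) \<le> op_norm M * norm x"
  for M :: "real^'n^'n"
  unfolding op_norm_def by (rule onorm[OF matrix_vector_mul_bounded_linear])

lemma op_norm_nonneg: "0 \<le> op_norm M" for M :: "real^'n^'n"
  unfolding op_norm_def by (rule onorm_pos_le[OF matrix_vector_mul_bounded_linear])

text \<open>The ambient norm of a matrix is the Euclidean norm of its entries, each at most the
  operator norm. The comparison is needed because the hypotheses bound operator norms, while
  integrability of matrix functions refers to the ambient norm.\<close>

lemma norm_le_op_norm: "norm M \<le> (real CARD('n))\<^sup>2 * op_norm M" for M :: "real^'n^'n"
proof -
  have "norm M \<le> (\<Sum>i\<in>UNIV. norm (M $ i))"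
    unfolding norm_vec_def by (rule L2_set_le_sum) simp
  also have "\<dots> \<le> (\<Sum>i\<in>(UNIV::'n set). \<Sum>j\<in>(UNIV::'n set). \<bar>M $ i $ j\<bar>)"
    by (intro sum_mono norm_le_l1_cart)
  also have "\<dots> \<le> (\<Sum>i\<in>(UNIV::'n set). \<Sum>j\<in>(UNIV::'n set). op_norm M)"
    unfolding op_norm_def by (intro sum_mono matrix_component_le_onorm)
  finally show ?thesis by (simp add: power2_eq_square mult.assoc)
qed

lemma op_norm_triangle_sub: "op_norm M \<le> op_norm M' + op_norm (M - M')" for M :: "real^'n^'n"
proof -
  have "onorm (\<lambda>x. M' *v x + (M - M') *v x) \<le> onorm ((*v) M') + onorm ((*v) (M - M'))"
    by (intro onorm_triangle matrix_vector_mul_bounded_linear)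
  then show ?thesis by (simp add: op_norm_def matrix_vector_mult_diff_rdistrib)
qed

lemma bounded_bilinear_matrix_vector_mult: "bounded_bilinear ((*v) :: real^'n^'m \<Rightarrow> _)"
  unfolding bilinear_conv_bounded_bilinear[symmetric] bilinear_def
  by (auto intro!: linearI simp: matrix_vector_mult_add_rdistrib matrix_vector_right_distrib
      matrix_vector_mult_scaleR scaleR_matrix_vector_assoc)

lemma bounded_bilinear_matrix_matrix_mult: "bounded_bilinear ((**) :: real^'n^'m \<Rightarrow> real^'k^'n \<Rightarrow> _)"
  unfolding bilinear_conv_bounded_bilinear[symmetric] bilinear_def
  by (auto intro!: linearI simp: vec_eq_iff matrix_matrix_mult_def sum.distrib algebra_simps sum_distrib_left)

lemmas continuous_on_matrix_vector_mult [continuous_intros] =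
  bounded_bilinear.continuous_on[OF bounded_bilinear_matrix_vector_mult]

lemmas continuous_on_matrix_matrix_mult [continuous_intros] =
  bounded_bilinear.continuous_on[OF bounded_bilinear_matrix_matrix_mult]

lemmas bounded_linear_matrix_vector_left =
  bounded_bilinear.bounded_linear_left[OF bounded_bilinear_matrix_vector_mult]

lemma matrix_inv_inverse:
  assumes "invertible M"
  shows "M ** matrix_inv M = mat 1" "matrix_inv M ** M = mat 1"
  using someI_ex[OF assms[unfolded invertible_def]] unfolding matrix_inv_def by auto

lemma continuous_on_det: "continuous_on S (\<lambda>t. det (F t))"
  if "continuous_on S F" for F :: "'a::topological_space \<Rightarrow> real^'n^'n"
  unfolding det_def using that by (intro continuous_intros)

text \<open>Cramer's rule writes the entries of the inverse as quotients of determinants, which are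
  polynomials in the entries.\<close>

lemma continuous_on_matrix_inv:
  fixes F :: "'a::topological_space \<Rightarrow> real^'n^'n"
  assumes F: "continuous_on S F" and inv: "\<And>t. t \<in> S \<Longrightarrow> invertible (F t)"
  shows "continuous_on S (\<lambda>t. matrix_inv (F t))"
proof -
  define G where "G = (\<lambda>t. \<chi> i j. det (\<chi> k l. if l = i then axis j 1 $ k else F t $ k $ l) / det (F t))"
  have "matrix_inv (F t) = G t" if t: "t \<in> S" for t
  proof -
    have "matrix_inv (F t) *v axis j 1
        = (\<chi> i. det (\<chi> k l. if l = i then axis j 1 $ k else F t $ k $ l) / det (F t))" for j
      using cramer[of "F t" "matrix_inv (F t) *v axis j 1" "axis j 1"] inv[OF t]
      by (simp add: matrix_vector_mul_assoc matrix_inv_inverse invertible_det_nz)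
    then show ?thesis
      by (simp add: G_def matrix_vector_mult_basis vec_eq_iff column_def)
  qed
  moreover have num: "continuous_on S (\<lambda>t. det (\<chi> k l. if l = i then axis j 1 $ k else F t $ k $ l))"
    for i j :: 'n
  proof (intro continuous_on_det continuous_on_vec_lambda)
    fix k l :: 'n
    show "continuous_on S (\<lambda>t. if l = i then axis j 1 $ k else F t $ k $ l)"
      using F by (cases "l = i") (auto intro!: continuous_intros)
  qed
  moreover have "continuous_on S G"
    unfolding G_def using inv
    by (intro continuous_on_vec_lambda continuous_on_divide num continuous_on_det[OF F])
      (auto simp: invertible_det_nz)
  ultimately show ?thesis by (metis (no_types, lifting) continuous_on_cong)
qed

lemma absolutely_integrable_dominated:
  fixes q :: "real \<Rightarrow> 'a::euclidean_space"
  assumes "continuous_on {0..} q" "b absolutely_integrable_on {0..}"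
    and "\<And>t. t \<ge> 0 \<Longrightarrow> norm (q t) \<le> b t"
  shows "q absolutely_integrable_on {0..}"
  using assms set_lebesgue_integral_eq_integral(1)[OF assms(2)]
  by (intro measurable_bounded_by_integrable_imp_absolutely_integrable[where g = b]
      continuous_imp_measurable_on_sets_lebesgue) auto

text \<open>If \<open>a\<close> bounds \<open>A\<close> on the compact interval,
  \<open>|x|^2\<close> times \<open>exp (2 * a * s)\<close> cannot decrease, so vanishing at
  \<open>t\<close> forces vanishing at 0. This uniqueness statement makes every \<Phi>(t)
  invertible.\<close>

lemma ode_zero_backward:
  fixes x :: "real \<Rightarrow> real^'n" and A :: "real \<Rightarrow> real^'n^'n"
  assumes A: "continuous_on {0..} A" and t: "t \<ge> 0"
    and x: "\<And>s. s \<ge> 0 \<Longrightarrow> (x has_vector_derivative A s *v x s) (at s within {0..})"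
    and "x t = 0"
  shows "x 0 = 0"
proof -
  have "bounded (A ` {0..t})"
    using A by (intro compact_imp_bounded compact_continuous_image) (auto elim: continuous_on_subset)
  then obtain B where B: "\<And>s. s \<in> {0..t} \<Longrightarrow> norm (A s) \<le> B"
    unfolding bounded_iff by blast
  define a where "a = (real CARD('n))\<^sup>2 * B"
  have a: "norm (A s *v z) \<le> a * norm z" if "s \<in> {0..t}" for s z
  proof -
    have "op_norm (A s) \<le> (\<Sum>i\<in>(UNIV::'n set). \<Sum>j\<in>(UNIV::'n set). \<bar>A s $ i $ j\<bar>)"
      unfolding op_norm_def by (rule onorm_le_matrix_component_sum)
    also have "\<dots> \<le> (\<Sum>i\<in>(UNIV::'n set). \<Sum>j\<in>(UNIV::'n set). B)"
      using B[OF that] by (intro sum_mono) (meson component_le_norm_cart order_trans Finite_Cartesian_Product.norm_nth_le)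
    finally have "op_norm (A s) \<le> a" by (simp add: a_def power2_eq_square mult.assoc)
    then show ?thesis
      by (meson norm_matrix_vector_le mult_right_mono norm_ge_zero order_trans)
  qed
  define e where "e = (\<lambda>s. (x s \<bullet> x s) * exp (2 * a * s))"
  have cont: "continuous_on {0..t} x"
    using x by (intro continuous_on_subset[OF continuous_on_vector_derivative, of "{0..}"]) auto
  have "e 0 \<le> e t"
  proof (rule DERIV_nonneg_imp_increasing_open[where f = e])
    show "0 \<le> t" by fact
    show "continuous_on {0..t} e" unfolding e_def using cont by (intro continuous_intros)
    fix s assume s: "0 < s" "s < t"
    have "(x has_vector_derivative A s *v x s) (at s)"
      using x[of s] s by (simp add: at_within_interior[of s "{0..}"])
    from bounded_bilinear.has_vector_derivative[OF bounded_bilinear_inner this this]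
    have "((\<lambda>s. x s \<bullet> x s) has_real_derivative 2 * (x s \<bullet> (A s *v x s))) (at s)"
      by (simp add: has_real_derivative_iff_has_vector_derivative inner_commute)
    then have "(e has_real_derivative
        (2 * (x s \<bullet> (A s *v x s)) + 2 * a * (x s \<bullet> x s)) * exp (2 * a * s)) (at s)"
      unfolding e_def by (auto intro!: derivative_eq_intros simp: algebra_simps)
    moreover have "\<bar>x s \<bullet> (A s *v x s)\<bar> \<le> norm (x s) * (a * norm (x s))"
      using Cauchy_Schwarz_ineq2[of "x s" "A s *v x s"] a[of s "x s"] s
      by (meson atLeastAtMost_iff less_imp_le mult_left_mono norm_ge_zero order_trans)
    then have "0 \<le> 2 * (x s \<bullet> (A s *v x s)) + 2 * a * (x s \<bullet> x s)"
      by (simp add: dot_square_norm power2_eq_square algebra_simps)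
    ultimately show "\<exists>y. (e has_real_derivative y) (at s) \<and> 0 \<le> y"
      using mult_nonneg_nonneg[OF _ exp_ge_zero] by blast
  qed
  then have "x 0 \<bullet> x 0 \<le> 0" using \<open>x t = 0\<close> by (simp add: e_def)
  then show ?thesis by (metis inner_gt_zero_iff not_less)
qed

subsection \<open>Bounded solutions of the linear problem\<close>

text \<open>Continuity is included because Duhamel's formula must be differentiable at every time;
  it also supplies measurability in domination arguments.\<close>

definition L1C :: "(real \<Rightarrow> 'a::euclidean_space) set" where
  "L1C = {q. continuous_on {0..} q \<and> q absolutely_integrable_on {0..}}"

definition L1_norm :: "(real \<Rightarrow> 'a::euclidean_space) \<Rightarrow> real" where
  "L1_norm q = integral {0..} (\<lambda>t. norm (q t))"

lemma L1C_D:
  assumes "q \<in> L1C"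
  shows "continuous_on {0..} q" "q absolutely_integrable_on {0..}" "q integrable_on {0..}"
    "(\<lambda>t. norm (q t)) integrable_on {0..}" "0 \<le> L1_norm q"
  using assms by (auto simp: L1C_def L1_norm_def absolutely_integrable_on_def intro: integral_nonneg)

lemma L1C_dominated:
  fixes q :: "real \<Rightarrow> 'a::euclidean_space"
  assumes "continuous_on {0..} q" "b absolutely_integrable_on {0..}"
    and "\<And>t. t \<ge> 0 \<Longrightarrow> norm (q t) \<le> b t"
  shows "q \<in> L1C" "L1_norm q \<le> integral {0..} b"
proof -
  show q: "q \<in> L1C" unfolding L1C_def using absolutely_integrable_dominated[OF assms] assms by simp
  show "L1_norm q \<le> integral {0..} b"
    unfolding L1_norm_def using L1C_D(4)[OF q] assms
    by (intro integral_le) (auto simp: absolutely_integrable_on_def)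
qed

lemma L1C_scaleR: "q \<in> L1C \<Longrightarrow> (\<lambda>t. c *\<^sub>R q t) \<in> L1C"
  by (auto simp: L1C_def intro!: continuous_intros)

lemma L1C_diff: "q \<in> L1C \<Longrightarrow> r \<in> L1C \<Longrightarrow> (\<lambda>t. q t - r t) \<in> L1C"
  by (auto simp: L1C_def intro!: continuous_intros set_integral_diff)

lemma L1C_matrix_vector:
  fixes Q :: "real \<Rightarrow> real^'n^'n"
  assumes Q: "Q \<in> L1C" and x: "continuous_on {0..} x" and b: "\<And>t. t \<ge> 0 \<Longrightarrow> norm (x t) \<le> b"
    and o: "p absolutely_integrable_on {0..}" "\<And>t. t \<ge> 0 \<Longrightarrow> op_norm (Q t) \<le> p t"
  shows "(\<lambda>t. Q t *v x t) \<in> L1C" "L1_norm (\<lambda>t. Q t *v x t) \<le> integral {0..} p * b"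
proof -
  have *: "norm (Q t *v x t) \<le> p t * b" if "t \<ge> 0" for t
    using norm_matrix_vector_le[of "Q t" "x t"] o(2)[OF that] b[OF that] op_norm_nonneg[of "Q t"]
    by (meson mult_mono norm_ge_zero order_trans)
  have "(\<lambda>t. p t * b) absolutely_integrable_on {0..}" using o(1) by simp
  moreover have "continuous_on {0..} (\<lambda>t. Q t *v x t)"
    using x L1C_D[OF Q] by (intro continuous_intros)
  ultimately show "(\<lambda>t. Q t *v x t) \<in> L1C" "L1_norm (\<lambda>t. Q t *v x t) \<le> integral {0..} p * b"
    using L1C_dominated[OF _ _ *] by auto
qed

section \<open>Bounded continuous functions on the half line\<close>

lemma BC_I:
  assumes "continuous_on {0..} x" "\<And>t. t \<ge> 0 \<Longrightarrow> norm (x t) \<le> b"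
  shows "x \<in> BC"
  using assms by (auto simp: BC_def bounded_iff)

lemma BC_D:
  assumes "x \<in> BC"
  shows "continuous_on {0..} x" and "\<exists>b. \<forall>t\<ge>0. norm (x t) \<le> b"
  using assms by (auto simp: BC_def bounded_iff)

lemma BC_add: "x \<in> BC \<Longrightarrow> y \<in> BC \<Longrightarrow> (\<lambda>t. x t + y t) \<in> BC"
  unfolding BC_def by (auto intro: continuous_on_add bounded_plus_comp)

lemma BC_scaleR: "x \<in> BC \<Longrightarrow> (\<lambda>t. c *\<^sub>R x t) \<in> BC"
  unfolding BC_def by (auto intro!: continuous_intros bounded_scaleR_comp)

lemma BC_diff: "x \<in> BC \<Longrightarrow> y \<in> BC \<Longrightarrow> (\<lambda>t. x t - y t) \<in> BC"
  using BC_add[OF _ BC_scaleR[of y "-1"]] by simp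

lemma BC_zero: "(\<lambda>t. 0) \<in> BC"
  by (rule BC_I[where b = 0]) auto

lemma BC_cong:
  assumes "x \<in> BC" "\<And>t. t \<ge> 0 \<Longrightarrow> x t = y t"
  shows "y \<in> BC"
  using assms continuous_on_cong[of "{0..}" "{0..}" x y] image_cong[of "{0..}" "{0..}" x y]
  by (auto simp: BC_def)

lemma sup_norm_le: "(\<And>t. t \<ge> 0 \<Longrightarrow> norm (x t) \<le> b) \<Longrightarrow> sup_norm x \<le> b"
  unfolding sup_norm_def by (intro cSUP_least) auto

lemma sup_norm_nonneg:
  assumes "x \<in> BC"
  shows "0 \<le> sup_norm x"
proof -
  obtain b where "\<forall>t\<ge>0. norm (x t) \<le> b" using BC_D(2)[OF assms] by blast
  then have "norm (x 0) \<le> sup_norm x"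
    unfolding sup_norm_def by (intro cSUP_upper) (auto intro!: bdd_aboveI2)
  then show ?thesis using norm_ge_zero order_trans by blast
qed

section \<open>The fundamental matrix and Duhamel's operator\<close>

locale bounded_fundamental =
  fixes A \<Phi> :: "real \<Rightarrow> real^'n^'n" and K :: real
  assumes A_cont: "continuous_on {0..} A"
    and Phi: "fundamental_matrix A \<Phi>"
    and K: "\<And>s t. \<lbrakk>0 \<le> s; s \<le> t\<rbrakk> \<Longrightarrow> op_norm (\<Phi> t ** matrix_inv (\<Phi> s)) \<le> K"
begin

lemma Phi_0: "\<Phi> 0 = mat 1"
  using Phi by (simp add: fundamental_matrix_def)

lemma Phi_deriv: "t \<ge> 0 \<Longrightarrow> (\<Phi> has_vector_derivative A t ** \<Phi> t) (at t within {0..})"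
  using Phi by (simp add: fundamental_matrix_def)

lemma Phi_cont: "continuous_on {0..} \<Phi>"
  using Phi_deriv by (intro continuous_on_vector_derivative) auto

lemma Phi_vector_deriv:
  "t \<ge> 0 \<Longrightarrow> ((\<lambda>t. \<Phi> t *v w) has_vector_derivative A t *v (\<Phi> t *v w)) (at t within {0..})"
  using bounded_linear.has_vector_derivative[OF bounded_linear_matrix_vector_left Phi_deriv, of t w]
  by (simp add: matrix_vector_mul_assoc)

lemma Phi_invertible:
  assumes "t \<ge> 0"
  shows "invertible (\<Phi> t)"
proof -
  have "w = 0" if "\<Phi> t *v w = 0" for w
    using ode_zero_backward[OF A_cont assms Phi_vector_deriv that] by (simp add: Phi_0)
  then show ?thesis
    by (simp add: invertible_left_inverse matrix_left_invertible_ker)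
qed

lemma Phi_inv_cont: "continuous_on {0..} (\<lambda>t. matrix_inv (\<Phi> t))"
  using Phi_cont Phi_invertible by (intro continuous_on_matrix_inv) auto

lemma K_nonneg: "0 \<le> K"
  using K[of 0 0] op_norm_nonneg order_trans by blast

lemma Phi_op_norm: "t \<ge> 0 \<Longrightarrow> op_norm (\<Phi> t) \<le> K"
  using K[of 0 t] matrix_inv_inverse(1)[of "\<Phi> 0"] Phi_invertible[of 0] by (simp add: Phi_0)

lemma Phi_norm: "t \<ge> 0 \<Longrightarrow> norm (\<Phi> t *v w) \<le> K * norm w"
  using norm_matrix_vector_le[of "\<Phi> t" w] Phi_op_norm[of t]
  by (meson mult_right_mono norm_ge_zero order_trans)

lemma Phi_BC: "(\<lambda>t. \<Phi> t *v w) \<in> BC"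
  using Phi_cont Phi_norm by (intro BC_I[where b = "K * norm w"] continuous_intros)

lemma duhamel_integrand_cont:
  "continuous_on {0..} q \<Longrightarrow> continuous_on {0..} (\<lambda>s. matrix_inv (\<Phi> s) *v q s)"
  using Phi_inv_cont by (intro continuous_intros)

lemma duhamel_integrable:
  assumes "continuous_on {0..} q"
  shows "(\<lambda>s. matrix_inv (\<Phi> s) *v q s) integrable_on {0..t}"
  using continuous_on_subset[OF duhamel_integrand_cont[OF assms], of "{0..t}"]
  by (intro integrable_continuous_real) auto

lemma duhamel_deriv:
  assumes q: "continuous_on {0..} q" and t: "t \<ge> 0"
  shows "(duhamel \<Phi> q has_vector_derivative A t *v duhamel \<Phi> q t + q t) (at t within {0..})"
proof -
  let ?p = "\<lambda>s. matrix_inv (\<Phi> s) *v q s"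
  \<comment> \<open>Ending the interval at \<open>t + 1\<close> makes it agree with the half line
    near \<open>t\<close>, which also covers the one-sided derivative at 0.\<close>
  have "((\<lambda>u. integral {0..u} ?p) has_vector_derivative ?p t) (at t within {0..t+1})"
    using continuous_on_subset[OF duhamel_integrand_cont[OF q], of "{0..t+1}"] t
    by (intro integral_has_vector_derivative) auto
  also have "at t within {0..t+1} = at t within {0..}"
    by (rule at_within_nhd[of _ "{..<t+1}"]) auto
  finally have "((\<lambda>u. integral {0..u} ?p) has_vector_derivative ?p t) (at t within {0..})" .
  from bounded_bilinear.has_vector_derivative[OF bounded_bilinear_matrix_vector_mult Phi_deriv[OF t] this]
  show ?thesis
    unfolding duhamel_def
    by (simp add: matrix_vector_mul_assoc matrix_inv_inverse(1)[OF Phi_invertible[OF t]] add.commute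
        matrix_mul_assoc)
qed

lemma duhamel_cont: "continuous_on {0..} q \<Longrightarrow> continuous_on {0..} (duhamel \<Phi> q)"
  using duhamel_deriv by (intro continuous_on_vector_derivative) auto

text \<open>Moving \<Phi>(t) under the integral produces the kernel
  \<open>\<Phi> t ** matrix_inv (\<Phi> s)\<close>, bounded by \<open>K\<close> in operator norm
  even if the inverse alone is unbounded. Hence L1 forcing gives bounded solutions.\<close>

lemma duhamel_norm:
  assumes q: "q \<in> L1C" and t: "t \<ge> 0"
  shows "norm (duhamel \<Phi> q t) \<le> K * L1_norm q"
proof -
  note qD = L1C_D[OF q]
  let ?p = "\<lambda>s. matrix_inv (\<Phi> s) *v q s"
  have p: "?p integrable_on {0..t}" by (rule duhamel_integrable[OF qD(1)])
  have int: "(\<lambda>s. norm (q s)) integrable_on {0..t}"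
    using qD(1) by (intro integrable_continuous_real continuous_on_norm) (auto elim: continuous_on_subset)
  have "duhamel \<Phi> q t = integral {0..t} (\<lambda>s. \<Phi> t *v ?p s)"
    unfolding duhamel_def
    using integral_linear[OF p matrix_vector_mul_bounded_linear[of "\<Phi> t"]] by (simp add: o_def)
  also have "norm \<dots> \<le> integral {0..t} (\<lambda>s. K * norm (q s))"
  proof (rule integral_norm_bound_integral)
    show "(\<lambda>s. \<Phi> t *v ?p s) integrable_on {0..t}"
      using integrable_linear[OF p matrix_vector_mul_bounded_linear[of "\<Phi> t"]] by (simp add: o_def)
    show "(\<lambda>s. K * norm (q s)) integrable_on {0..t}" using int by (rule integrable_on_mult_right)
    show "norm (\<Phi> t *v ?p s) \<le> K * norm (q s)" if "s \<in> {0..t}" for s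
      using norm_matrix_vector_le[of "\<Phi> t ** matrix_inv (\<Phi> s)" "q s"] K[of s t] that
      unfolding matrix_vector_mul_assoc
      by (meson atLeastAtMost_iff mult_right_mono norm_ge_zero order_trans)
  qed
  also have "\<dots> = K * integral {0..t} (\<lambda>s. norm (q s))" by simp
  also have "\<dots> \<le> K * L1_norm q"
    unfolding L1_norm_def using int qD K_nonneg
    by (intro mult_left_mono integral_subset_le) auto
  finally show ?thesis .
qed

lemma duhamel_BC: "q \<in> L1C \<Longrightarrow> duhamel \<Phi> q \<in> BC"
  using duhamel_cont duhamel_norm L1C_D(1) by (intro BC_I) auto

lemma duhamel_add:
  assumes "q \<in> L1C" "r \<in> L1C"
  shows "duhamel \<Phi> (\<lambda>t. q t + r t) t = duhamel \<Phi> q t + duhamel \<Phi> r t"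
  using assms duhamel_integrable[OF L1C_D(1)]
  by (simp add: duhamel_def matrix_vector_right_distrib integral_add)

lemma duhamel_scaleR: "duhamel \<Phi> (\<lambda>t. c *\<^sub>R q t) t = c *\<^sub>R duhamel \<Phi> q t"
  by (simp add: duhamel_def matrix_vector_mult_scaleR)

lemma duhamel_0: "duhamel \<Phi> q 0 = 0"
  by (simp add: duhamel_def)

lemma duhamel_matrix_vector:
  assumes "Q \<in> L1C"
  shows "duhamel_matrix \<Phi> Q t *v w = duhamel \<Phi> (\<lambda>s. Q s *v w) t"
proof -
  have "continuous_on {0..t} (\<lambda>s. matrix_inv (\<Phi> s) ** Q s)"
    using continuous_on_subset[OF Phi_inv_cont, of "{0..t}"] continuous_on_subset[OF L1C_D(1)[OF assms], of "{0..t}"]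
    by (intro continuous_intros) auto
  then have "(\<lambda>s. matrix_inv (\<Phi> s) ** Q s) integrable_on {0..t}" by (rule integrable_continuous_real)
  from integral_linear[OF this bounded_linear_matrix_vector_left[of w]]
  show ?thesis
    by (simp add: duhamel_matrix_def duhamel_def o_def matrix_vector_mul_assoc[symmetric])
qed

end

text \<open>The bound is stated for every pointwise bound \<open>b\<close> on the half line instead
  of \<open>sup_norm\<close>, so that estimates need no supremum; \<open>B\<close> is nonnegative so
  that it can multiply inequalities.\<close>

locale BC_functional =
  fixes \<Gamma> :: "(real \<Rightarrow> real^'n) \<Rightarrow> real^'n" and B :: real
  assumes add: "\<And>x y. \<lbrakk>x \<in> BC; y \<in> BC\<rbrakk> \<Longrightarrow> \<Gamma> (\<lambda>t. x t + y t) = \<Gamma> x + \<Gamma> y"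
    and scaleR: "\<And>c x. x \<in> BC \<Longrightarrow> \<Gamma> (\<lambda>t. c *\<^sub>R x t) = c *\<^sub>R \<Gamma> x"
    and B: "0 \<le> B"
    and bound: "\<And>x b. \<lbrakk>x \<in> BC; \<And>t. t \<ge> 0 \<Longrightarrow> norm (x t) \<le> b\<rbrakk> \<Longrightarrow> norm (\<Gamma> x) \<le> B * b"
begin

lemma diff:
  assumes "x \<in> BC" "y \<in> BC"
  shows "\<Gamma> (\<lambda>t. x t - y t) = \<Gamma> x - \<Gamma> y"
  using add[OF assms(1) BC_scaleR[OF assms(2)], of "-1"] scaleR[OF assms(2), of "-1"] by simp

text \<open>The difference has pointwise bound 0 on the half line, so \<Gamma> kills it. This
  reconciles functions that differ only at negative times.\<close>

lemma cong:
  assumes "x \<in> BC" "\<And>t. t \<ge> 0 \<Longrightarrow> x t = y t"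
  shows "\<Gamma> x = \<Gamma> y"
proof -
  have y: "y \<in> BC" using BC_cong assms by blast
  have "norm (\<Gamma> (\<lambda>t. x t - y t)) \<le> B * 0"
    using assms by (intro bound BC_diff y) auto
  then show ?thesis using diff[OF assms(1) y] by simp
qed

lemma sum:
  assumes "finite I" "\<And>i. i \<in> I \<Longrightarrow> x i \<in> BC"
  shows "(\<lambda>t. \<Sum>i\<in>I. c i *\<^sub>R x i t) \<in> BC \<and> \<Gamma> (\<lambda>t. \<Sum>i\<in>I. c i *\<^sub>R x i t) = (\<Sum>i\<in>I. c i *\<^sub>R \<Gamma> (x i))"
  using assms
proof (induction I rule: finite_induct)
  case empty
  show ?case using scaleR[OF BC_zero, of 0] BC_zero by simp
next
  case (insert i I)
  then show ?case
    using BC_add[OF BC_scaleR[of "x i" "c i"], of "\<lambda>t. \<Sum>i\<in>I. c i *\<^sub>R x i t"]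
      add[OF BC_scaleR[of "x i" "c i"], of "\<lambda>t. \<Sum>i\<in>I. c i *\<^sub>R x i t"] scaleR[of "x i" "c i"]
    by simp
qed

lemma columnwise_mult:
  assumes "\<And>j. (\<lambda>t. M t *v axis j 1) \<in> BC"
  shows "columnwise \<Gamma> M *v w = \<Gamma> (\<lambda>t. M t *v w)"
proof -
  have "\<Gamma> (\<lambda>t. M t *v w) = \<Gamma> (\<lambda>t. \<Sum>j\<in>UNIV. w $ j *\<^sub>R (M t *v axis j 1))"
    by (simp add: matrix_mult_sum[of _ w] matrix_vector_mult_basis scalar_mult_eq_scaleR)
  also have "\<dots> = (\<Sum>j\<in>UNIV. w $ j *\<^sub>R \<Gamma> (\<lambda>t. M t *v axis j 1))"
    using sum[where x = "\<lambda>j t. M t *v axis j 1" and c = "\<lambda>j. w $ j", OF finite assms] by simp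
  also have "\<dots> = columnwise \<Gamma> M *v w"
    by (simp add: matrix_mult_sum[of _ w] scalar_mult_eq_scaleR matrix_vector_mult_basis column_def columnwise_def
        vec_eq_iff)
  finally show ?thesis by simp
qed

end

lemma BC_functional_exists:
  assumes "bounded_linear_BC \<Gamma>"
  obtains B where "BC_functional \<Gamma> B"
proof -
  obtain B where B: "\<forall>x\<in>BC. norm (\<Gamma> x) \<le> B * sup_norm x"
    using assms by (auto simp: bounded_linear_BC_def)
  have "BC_functional \<Gamma> \<bar>B\<bar>"
  proof
    fix x :: "real \<Rightarrow> real^'a" and b
    assume x: "x \<in> BC" "\<And>t. t \<ge> 0 \<Longrightarrow> norm (x t) \<le> b"
    have "norm (\<Gamma> x) \<le> B * sup_norm x" using B x by blast
    also have "\<dots> \<le> \<bar>B\<bar> * b"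
      using sup_norm_nonneg[OF x(1)] sup_norm_le[OF x(2)] by (intro mult_mono) auto
    finally show "norm (\<Gamma> x) \<le> \<bar>B\<bar> * b" .
  qed (use assms in \<open>auto simp: bounded_linear_BC_def\<close>)
  then show ?thesis by (rule that)
qed

section \<open>The solvability defect of the linear boundary value problem\<close>

locale linear_bvp = bounded_fundamental A \<Phi> K + BC_functional \<Gamma> B
  for A \<Phi> :: "real \<Rightarrow> real^'n^'n" and K and \<Gamma> :: "(real \<Rightarrow> real^'n) \<Rightarrow> real^'n" and B
begin

text \<open>\<open>p\<close> is the integrand in the boundary condition, \<open>q\<close> the
  forcing in the differential equation. On integrable continuous pairs the expression is jointly
  linear, so the nonlinear map, its derivative and its remainder all have this form and share one
  estimate.\<close>

definition defect :: "(real \<Rightarrow> real^'n) \<Rightarrow> (real \<Rightarrow> real^'n) \<Rightarrow> real^'n" where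
  "defect p q = integral {0..} p - \<Gamma> (duhamel \<Phi> q)"

lemma defect_norm:
  assumes p: "p \<in> L1C" and q: "q \<in> L1C"
  shows "norm (defect p q) \<le> L1_norm p + B * K * L1_norm q"
proof -
  have "norm (integral {0..} p) \<le> L1_norm p"
    unfolding L1_norm_def using L1C_D[OF p] by (intro integral_norm_bound_integral) auto
  moreover have "norm (\<Gamma> (duhamel \<Phi> q)) \<le> B * (K * L1_norm q)"
    using q by (intro bound duhamel_BC duhamel_norm)
  ultimately show ?thesis
    using norm_triangle_ineq4[of "integral {0..} p" "\<Gamma> (duhamel \<Phi> q)"]
    by (simp add: defect_def mult.assoc)
qed

lemma defect_add:
  assumes "p \<in> L1C" "q \<in> L1C" "p' \<in> L1C" "q' \<in> L1C"
  shows "defect (\<lambda>t. p t + p' t) (\<lambda>t. q t + q' t) = defect p q + defect p' q'"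
proof -
  have "\<Gamma> (duhamel \<Phi> (\<lambda>t. q t + q' t)) = \<Gamma> (duhamel \<Phi> q) + \<Gamma> (duhamel \<Phi> q')"
    using add[OF duhamel_BC[OF assms(2)] duhamel_BC[OF assms(4)]]
    unfolding duhamel_add[OF assms(2,4), symmetric] by simp
  then show ?thesis using assms by (simp add: defect_def integral_add L1C_D)
qed

lemma defect_scaleR:
  assumes "p \<in> L1C" "q \<in> L1C"
  shows "defect (\<lambda>t. c *\<^sub>R p t) (\<lambda>t. c *\<^sub>R q t) = c *\<^sub>R defect p q"
proof -
  have "\<Gamma> (duhamel \<Phi> (\<lambda>t. c *\<^sub>R q t)) = c *\<^sub>R \<Gamma> (duhamel \<Phi> q)"
    using scaleR[OF duhamel_BC[OF assms(2)]] unfolding duhamel_scaleR[symmetric] by simp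
  then show ?thesis using assms by (simp add: defect_def L1C_D scaleR_diff_right)
qed

lemma defect_diff:
  assumes "p \<in> L1C" "q \<in> L1C" "p' \<in> L1C" "q' \<in> L1C"
  shows "defect (\<lambda>t. p t - p' t) (\<lambda>t. q t - q' t) = defect p q - defect p' q'"
  using defect_add[OF assms(1,2) L1C_scaleR[OF assms(3)] L1C_scaleR[OF assms(4)], of "-1" "-1"]
    defect_scaleR[OF assms(3,4), of "-1"] by simp

text \<open>Brings the matrix expression in \<phi> into vector form: applying a matrix to a fixed
  \<open>w\<close> commutes with both integrals, and with the columnwise action of \<Gamma> by
  linearity.\<close>

lemma defect_matrix:
  assumes "P \<in> L1C" "Q \<in> L1C" "\<And>w. (\<lambda>t. Q t *v w) \<in> L1C"
  shows "(integral {0..} P - columnwise \<Gamma> (duhamel_matrix \<Phi> Q)) *v w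
       = defect (\<lambda>t. P t *v w) (\<lambda>t. Q t *v w)"
proof -
  have *: "(\<lambda>t. duhamel_matrix \<Phi> Q t *v w) = duhamel \<Phi> (\<lambda>s. Q s *v w)" for w
    using duhamel_matrix_vector[OF assms(2)] by auto
  have "columnwise \<Gamma> (duhamel_matrix \<Phi> Q) *v w = \<Gamma> (duhamel \<Phi> (\<lambda>s. Q s *v w))"
    using columnwise_mult[of "duhamel_matrix \<Phi> Q"] duhamel_BC[OF assms(3)] unfolding * by blast
  moreover have "integral {0..} P *v w = integral {0..} (\<lambda>t. P t *v w)"
    using integral_linear[OF L1C_D(3)[OF assms(1)] bounded_linear_matrix_vector_left[of w]]
    by (simp add: o_def)
  ultimately show ?thesis by (simp add: defect_def matrix_vector_mult_diff_rdistrib)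
qed

lemma columnwise_Phi: "columnwise \<Gamma> \<Phi> *v w = \<Gamma> (\<lambda>t. \<Phi> t *v w)"
  by (intro columnwise_mult Phi_BC)

end

subsection \<open>Superposition operators\<close>

text \<open>Constant continuation to negative times preserves the supremum, so the half line
  inherits completeness from the Banach space of bounded continuous functions on the whole
  line.\<close>

definition bc_ext :: "(real \<Rightarrow> real^'n) \<Rightarrow> (real \<Rightarrow>\<^sub>C (real^'n))" where
  "bc_ext x = Bcontfun (\<lambda>t. x (max t 0))"

lemma apply_bc_ext:
  assumes "x \<in> BC"
  shows "apply_bcontfun (bc_ext x) t = x (max t 0)"
proof -
  have "(\<lambda>t. x (max t 0)) \<in> bcontfun"
  proof -
    have "continuous_on UNIV (\<lambda>t. x (max t 0))"
      using BC_D(1)[OF assms] by (rule continuous_on_compose2) (auto intro!: continuous_intros)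
    moreover have "bounded (range (\<lambda>t. x (max t 0)))"
      using assms by (auto simp: BC_def intro: bounded_subset)
    ultimately show ?thesis by (simp add: bcontfun_def)
  qed
  then show ?thesis by (simp add: bc_ext_def Bcontfun_inverse)
qed

lemma bcontfun_BC: "apply_bcontfun X \<in> BC"
  unfolding BC_def by (auto intro: bounded_subset[OF bounded_apply_bcontfun])

lemma norm_bc_ext_le:
  assumes "x \<in> BC" "\<And>t. t \<ge> 0 \<Longrightarrow> norm (x t) \<le> b"
  shows "norm (bc_ext x) \<le> b"
  using assms by (intro norm_bound) (auto simp: apply_bc_ext)

lemma bc_ext_diff:
  assumes "x \<in> BC" "y \<in> BC"
  shows "bc_ext (\<lambda>t. x t - y t) = bc_ext x - bc_ext y"
  by (rule bcontfun_eqI) (simp add: apply_bc_ext assms BC_diff)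

section \<open>Remainder estimates for the nonlinearities\<close>

lemma jac_x_has_derivative:
  assumes "C1_map F"
  shows "((\<lambda>z. F (t, z)) has_derivative (\<lambda>d. jac_x F t x *v d)) (at x)"
proof -
  obtain F' where F': "\<And>z. (F has_derivative blinfun_apply (F' z)) (at z)"
    using assms by (auto simp: C1_map_def)
  have "((\<lambda>z. (t, z)) has_derivative (\<lambda>d. (0, d))) (at x)"
    by (auto intro!: derivative_eq_intros)
  from has_derivative_compose[OF this F'] have "(\<lambda>z. F (t, z)) differentiable (at x)"
    by (auto simp: differentiable_def)
  then show ?thesis unfolding jac_x_def by (simp add: jacobian_works)
qed

lemma C1_map_cont_comp:
  assumes "C1_map F" "continuous_on S x"
  shows "continuous_on S (\<lambda>t. F (t, x t))"
proof -
  obtain F' where "\<And>z. (F has_derivative blinfun_apply (F' z)) (at z)"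
    using assms by (auto simp: C1_map_def)
  then have "continuous_on UNIV F" by (intro has_derivative_continuous_on) auto
  then show ?thesis
    by (rule continuous_on_compose2) (use assms in \<open>auto intro!: continuous_intros\<close>)
qed

text \<open>The mean value inequality is applied to \<open>F (t, z)\<close> minus its linear part at
  the centre \<open>c\<close>, whose derivative on the ball is at most
  \<open>\<sigma> * \<delta>\<close>. Both \<open>a\<close> and \<open>b\<close> range over the
  ball, as strict differentiability requires.\<close>

lemma jac_x_remainder:
  assumes F: "C1_map F" and ab: "a \<in> cball c \<delta>" "b \<in> cball c \<delta>" and \<sigma>: "\<sigma> \<ge> 0"
    and lip: "\<And>z. z \<in> cball c \<delta> \<Longrightarrow> op_norm (jac_x F t z - jac_x F t c) \<le> \<sigma> * norm (z - c)"
  shows "norm (F (t, a) - F (t, b) - jac_x F t c *v (a - b)) \<le> \<sigma> * \<delta> * norm (a - b)"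
proof -
  let ?G = "\<lambda>z. F (t, z) - jac_x F t c *v z"
  have "norm (?G a - ?G b) \<le> \<sigma> * \<delta> * norm (a - b)"
  proof (rule differentiable_bound[OF convex_cball _ _ ab])
    fix z assume z: "z \<in> cball c \<delta>"
    show "(?G has_derivative (\<lambda>d. jac_x F t z *v d - jac_x F t c *v d)) (at z within cball c \<delta>)"
      by (intro has_derivative_diff has_derivative_at_withinI[OF jac_x_has_derivative[OF F]]
          bounded_linear_imp_has_derivative matrix_vector_mul_bounded_linear)
    have "(\<lambda>d. jac_x F t z *v d - jac_x F t c *v d) = (*v) (jac_x F t z - jac_x F t c)"
      by (simp add: fun_eq_iff matrix_vector_mult_diff_rdistrib)
    then have "onorm (\<lambda>d. jac_x F t z *v d - jac_x F t c *v d) \<le> \<sigma> * norm (z - c)"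
      using lip[OF z] by (simp add: op_norm_def)
    also have "\<dots> \<le> \<sigma> * \<delta>"
      using z \<sigma> by (intro mult_left_mono) (auto simp: dist_norm norm_minus_commute)
    finally show "onorm (\<lambda>d. jac_x F t z *v d - jac_x F t c *v d) \<le> \<sigma> * \<delta>" .
  qed
  then show ?thesis by (simp add: matrix_vector_mult_diff_distrib algebra_simps)
qed

text \<open>Common frame for \<open>f\<close> and \<open>g\<close>: the Lipschitz bound has the form
  given for \<open>f\<close> and implied by that for \<open>g\<close>. Integrability along bounded
  functions has a different source for each, hence the assumption \<open>comp_L1C\<close>.\<close>

locale nonlinearity =
  fixes F :: "real \<times> (real^'n) \<Rightarrow> real^'n" and s :: "real \<Rightarrow> real" and x0 :: "real \<Rightarrow> real^'n"
  assumes C1: "C1_map F"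
    and unif: "uniformly_continuous_on ({0..} \<times> UNIV) (\<lambda>(t, x). jac_x F t x)"
    and int_0: "(\<lambda>t. op_norm (jac_x F t 0)) absolutely_integrable_on {0..}"
    and s_int: "s absolutely_integrable_on {0..}"
    and lip: "\<And>S t x1 x2. \<lbrakk>compact S; t \<ge> 0; x1 \<in> S; x2 \<in> S\<rbrakk>
        \<Longrightarrow> op_norm (jac_x F t x1 - jac_x F t x2) \<le> s t * norm (x1 - x2)"
    and comp_L1C: "\<And>x. x \<in> BC \<Longrightarrow> (\<lambda>t. F (t, x t)) \<in> L1C"
    and x0: "x0 \<in> BC"
begin

definition J :: "real \<Rightarrow> real^'n^'n" where "J t = jac_x F t (x0 t)"

lemma abs_s_int: "(\<lambda>t. \<bar>s t\<bar>) absolutely_integrable_on {0..}"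
  using absolutely_integrable_norm[OF s_int] by (simp add: o_def)

text \<open>\<open>s\<close> is fixed before the compact set, so the two-point set
  \<open>{x1, x2}\<close> handles any pair; the absolute value makes the majorant
  nonnegative.\<close>

lemma lip_abs:
  assumes "t \<ge> 0"
  shows "op_norm (jac_x F t x1 - jac_x F t x2) \<le> \<bar>s t\<bar> * norm (x1 - x2)"
  using lip[of "{x1, x2}" t x1 x2] assms by (meson abs_ge_self finite_imp_compact finite.intros
      insertI1 insertI2 mult_right_mono norm_ge_zero order_trans)

lemma J_cont: "continuous_on {0..} J"
proof -
  have "continuous_on {0..} (\<lambda>t. (\<lambda>(t, x). jac_x F t x) (t, x0 t))"
    by (rule continuous_on_compose2[OF uniformly_continuous_imp_continuous[OF unif]])
      (use BC_D(1)[OF x0] in \<open>auto intro!: continuous_intros\<close>)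
  then show ?thesis by (simp add: J_def[abs_def])
qed

text \<open>Integrability of the Jacobian is given along 0; the Lipschitz bound carries it to
  \<open>x0\<close> at the cost \<open>\<bar>s t\<bar> * b\<close>, which is integrable because
  \<open>x0\<close> is bounded.\<close>

lemma J_dominated:
  obtains p where "p absolutely_integrable_on {0..}" "\<And>t. t \<ge> 0 \<Longrightarrow> op_norm (J t) \<le> p t"
proof -
  obtain b where b: "\<forall>t\<ge>0. norm (x0 t) \<le> b" using BC_D(2)[OF x0] by blast
  show ?thesis
  proof
    show "(\<lambda>t. op_norm (jac_x F t 0) + \<bar>s t\<bar> * b) absolutely_integrable_on {0..}"
      using int_0 abs_s_int by (intro set_integral_add) auto
    fix t :: real assume t: "t \<ge> 0"
    have "op_norm (J t) \<le> op_norm (jac_x F t 0) + \<bar>s t\<bar> * norm (x0 t)"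
      using op_norm_triangle_sub[of "J t" "jac_x F t 0"] lip_abs[OF t, of "x0 t" 0] by (simp add: J_def)
    also have "\<dots> \<le> op_norm (jac_x F t 0) + \<bar>s t\<bar> * b"
      using b t by (intro add_left_mono mult_left_mono) auto
    finally show "op_norm (J t) \<le> op_norm (jac_x F t 0) + \<bar>s t\<bar> * b" .
  qed
qed

lemma J_L1C: "J \<in> L1C"
proof -
  obtain p where p: "p absolutely_integrable_on {0..}" "\<And>t. t \<ge> 0 \<Longrightarrow> op_norm (J t) \<le> p t"
    using J_dominated by blast
  have "norm (J t) \<le> (real CARD('n))\<^sup>2 * p t" if "t \<ge> 0" for t
    using norm_le_op_norm[of "J t"] p(2)[OF that] by (meson mult_left_mono order_trans zero_le_power2)
  then show ?thesis
    using p(1) by (intro L1C_dominated(1)[OF J_cont, of "\<lambda>t. (real CARD('n))\<^sup>2 * p t"]) auto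
qed

lemma J_mult:
  "\<exists>C\<ge>0. \<forall>x b. continuous_on {0..} x \<longrightarrow> (\<forall>t\<ge>0. norm (x t) \<le> b)
        \<longrightarrow> (\<lambda>t. J t *v x t) \<in> L1C \<and> L1_norm (\<lambda>t. J t *v x t) \<le> C * b"
proof -
  obtain p where p: "p absolutely_integrable_on {0..}" "\<And>t. t \<ge> 0 \<Longrightarrow> op_norm (J t) \<le> p t"
    using J_dominated by blast
  have "p t \<ge> 0" if "t \<ge> 0" for t using p(2)[OF that] op_norm_nonneg order_trans by blast
  then have "integral {0..} p \<ge> 0"
    using p(1) by (intro integral_nonneg) (auto simp: absolutely_integrable_on_def)
  then show ?thesis
    using L1C_matrix_vector[OF J_L1C _ _ p] by (intro exI[of _ "integral {0..} p"]) auto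
qed

lemma J_BC: "x \<in> BC \<Longrightarrow> (\<lambda>t. J t *v x t) \<in> L1C"
  using J_mult BC_D by blast

lemma J_matrix_L1C:
  fixes M :: "real \<Rightarrow> real^'n^'n"
  assumes M: "continuous_on {0..} M" "\<And>t. t \<ge> 0 \<Longrightarrow> norm (M t) \<le> b"
  shows "(\<lambda>t. J t ** M t) \<in> L1C"
proof -
  obtain C where C: "C > 0" "\<And>(X :: real^'n^'n) (Y :: real^'n^'n). norm (X ** Y) \<le> norm X * norm Y * C"
    using bounded_bilinear.pos_bounded[OF bounded_bilinear_matrix_matrix_mult] by blast
  show ?thesis
  proof (rule L1C_dominated(1))
    show "continuous_on {0..} (\<lambda>t. J t ** M t)" using J_cont M by (intro continuous_intros)
    show "(\<lambda>t. norm (J t) * (b * C)) absolutely_integrable_on {0..}"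
      using L1C_D(2)[OF J_L1C] by (auto intro: absolutely_integrable_norm[unfolded o_def])
    show "norm (J t ** M t) \<le> norm (J t) * (b * C)" if "t \<ge> 0" for t
    proof -
      have "norm (J t ** M t) \<le> norm (J t) * norm (M t) * C" by (rule C)
      also have "\<dots> \<le> norm (J t) * b * C"
        using M(2)[OF that] C(1) by (intro mult_right_mono mult_left_mono) auto
      finally show ?thesis by (simp add: mult.assoc)
    qed
  qed
qed

text \<open>Integrating the pointwise mean value bound turns the weight \<open>s\<close> into the
  constant \<open>integral {0..} (\<lambda>t. \<bar>s t\<bar>)\<close>. The free factor \<delta>
  yields strict differentiability from the sup norm into L1.\<close>

lemma remainder:
  assumes x: "x \<in> BC" "x' \<in> BC"
    and near: "\<And>t. t \<ge> 0 \<Longrightarrow> norm (x t - x0 t) \<le> \<delta>" "\<And>t. t \<ge> 0 \<Longrightarrow> norm (x' t - x0 t) \<le> \<delta>"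
    and d: "\<And>t. t \<ge> 0 \<Longrightarrow> norm (x t - x' t) \<le> d"
  shows "(\<lambda>t. F (t, x t) - F (t, x' t) - J t *v (x t - x' t)) \<in> L1C"
    and "L1_norm (\<lambda>t. F (t, x t) - F (t, x' t) - J t *v (x t - x' t))
        \<le> integral {0..} (\<lambda>t. \<bar>s t\<bar>) * \<delta> * d"
proof -
  have \<delta>: "\<delta> \<ge> 0" using near(1)[of 0] norm_ge_zero order_trans by blast
  have "norm (F (t, x t) - F (t, x' t) - J t *v (x t - x' t)) \<le> \<bar>s t\<bar> * (\<delta> * d)" if t: "t \<ge> 0" for t
  proof -
    have "norm (F (t, x t) - F (t, x' t) - J t *v (x t - x' t)) \<le> \<bar>s t\<bar> * \<delta> * norm (x t - x' t)"
      unfolding J_def using near[OF t] lip_abs[OF t]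
      by (intro jac_x_remainder[OF C1]) (auto simp: dist_norm norm_minus_commute)
    also have "\<dots> \<le> \<bar>s t\<bar> * \<delta> * d" using d[OF t] \<delta> by (intro mult_left_mono) auto
    finally show ?thesis by (simp add: mult.assoc)
  qed
  moreover have "continuous_on {0..} (\<lambda>t. F (t, x t) - F (t, x' t) - J t *v (x t - x' t))"
    using x by (intro continuous_intros C1_map_cont_comp[OF C1] J_cont BC_D)
  moreover have "(\<lambda>t. \<bar>s t\<bar> * (\<delta> * d)) absolutely_integrable_on {0..}" using abs_s_int by simp
  ultimately have "(\<lambda>t. F (t, x t) - F (t, x' t) - J t *v (x t - x' t)) \<in> L1C"
    "L1_norm (\<lambda>t. F (t, x t) - F (t, x' t) - J t *v (x t - x' t))
      \<le> integral {0..} (\<lambda>t. \<bar>s t\<bar> * (\<delta> * d))"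
    using L1C_dominated by blast+
  then show "(\<lambda>t. F (t, x t) - F (t, x' t) - J t *v (x t - x' t)) \<in> L1C"
    "L1_norm (\<lambda>t. F (t, x t) - F (t, x' t) - J t *v (x t - x' t))
        \<le> integral {0..} (\<lambda>t. \<bar>s t\<bar>) * \<delta> * d"
    by (simp_all add: mult.assoc)
qed

lemma lipschitz:
  "\<exists>C. \<forall>x\<in>BC. \<forall>x'\<in>BC. \<forall>d. (\<forall>t\<ge>0. norm (x t - x0 t) \<le> 1 \<and> norm (x' t - x0 t) \<le> 1
        \<and> norm (x t - x' t) \<le> d)
      \<longrightarrow> L1_norm (\<lambda>t. F (t, x t) - F (t, x' t)) \<le> C * d"
proof -
  obtain C where C: "\<forall>x b. continuous_on {0..} x \<longrightarrow> (\<forall>t\<ge>0. norm (x t) \<le> b)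
        \<longrightarrow> (\<lambda>t. J t *v x t) \<in> L1C \<and> L1_norm (\<lambda>t. J t *v x t) \<le> C * b"
    using J_mult by blast
  show ?thesis
  proof (intro exI ballI allI impI)
    fix x x' d
    assume x: "x \<in> BC" "x' \<in> BC"
      and *: "\<forall>t\<ge>0. norm (x t - x0 t) \<le> 1 \<and> norm (x' t - x0 t) \<le> 1 \<and> norm (x t - x' t) \<le> d"
    then have near: "\<And>t. t \<ge> 0 \<Longrightarrow> norm (x t - x0 t) \<le> 1" "\<And>t. t \<ge> 0 \<Longrightarrow> norm (x' t - x0 t) \<le> 1"
      and d: "\<And>t. t \<ge> 0 \<Longrightarrow> norm (x t - x' t) \<le> d" by auto
    let ?r = "\<lambda>t. F (t, x t) - F (t, x' t) - J t *v (x t - x' t)"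
    have r: "?r \<in> L1C" "L1_norm ?r \<le> integral {0..} (\<lambda>t. \<bar>s t\<bar>) * 1 * d"
      using remainder[OF x near d] by auto
    have j: "(\<lambda>t. J t *v (x t - x' t)) \<in> L1C" "L1_norm (\<lambda>t. J t *v (x t - x' t)) \<le> C * d"
      using C[rule_format, OF continuous_on_diff[OF BC_D(1)[OF x(1)] BC_D(1)[OF x(2)]], of d] d by auto
    have "L1_norm (\<lambda>t. F (t, x t) - F (t, x' t)) \<le> L1_norm ?r + L1_norm (\<lambda>t. J t *v (x t - x' t))"
      unfolding L1_norm_def integral_add[OF L1C_D(4)[OF r(1)] L1C_D(4)[OF j(1)], symmetric]
    proof (rule integral_le)
      show "(\<lambda>t. norm (F (t, x t) - F (t, x' t))) integrable_on {0..}"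
        using L1C_D(4)[OF L1C_diff[OF comp_L1C[OF x(1)] comp_L1C[OF x(2)]]] .
      show "(\<lambda>t. norm (?r t) + norm (J t *v (x t - x' t))) integrable_on {0..}"
        by (intro integrable_add L1C_D(4)[OF r(1)] L1C_D(4)[OF j(1)])
      show "norm (F (t, x t) - F (t, x' t)) \<le> norm (?r t) + norm (J t *v (x t - x' t))" for t
        by (metis norm_triangle_ineq diff_add_cancel)
    qed
    then show "L1_norm (\<lambda>t. F (t, x t) - F (t, x' t)) \<le> (integral {0..} (\<lambda>t. \<bar>s t\<bar>) + C) * d"
      using r(2) j(2) by (simp add: algebra_simps)
  qed
qed

end

subsection \<open>The perturbed problem\<close>

text \<open>Fredholm alternative in finite dimension: the kernel of \<open>transpose W\<close> is
  the orthogonal complement of the column span of \<open>W\<close>. That span is the kernel of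
  \<open>transpose M\<close>, itself the complement of the range of \<open>M\<close>, and the double
  complement is the range.\<close>

lemma range_eq_kernel_transpose:
  fixes M :: "real^'n^'n" and W :: "real^'p^'n"
  assumes "span (columns W) = matrix_ker (transpose M)"
  shows "{r. transpose W *v r = 0} = range ((*v) M)"
proof -
  have "range ((*v) W) = span (columns W)"
  proof
    show "range ((*v) W) \<subseteq> span (columns W)"
      using matrix_vector_mult_in_columnspace by blast
    have "columns W \<subseteq> range ((*v) W)"
      by (auto simp: columns_def matrix_vector_mult_basis[symmetric])
    then show "span (columns W) \<subseteq> range ((*v) W)"
      by (rule span_minimal) (simp add: linear_subspace_image)
  qed
  then have W: "range ((*v) W) = ((*v) (transpose M)) -` {0}"
    using assms by (auto simp: matrix_ker_def)
  have ker: "(*v) (transpose N) -` {0} = (range ((*v) N))\<^sup>\<bottom>" for N :: "real^'q^'n"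
    using ker_orthogonal_comp_adjoint[of "(*v) (transpose N)"]
    by (simp add: adjoint_matrix transpose_transpose)
  have "{r. transpose W *v r = 0} = (range ((*v) M))\<^sup>\<bottom>\<^sup>\<bottom>"
    using ker[of W] unfolding W ker[of M] by auto
  also have "\<dots> = range ((*v) M)"
    by (intro orthogonal_comp_self linear_subspace_image) auto
  finally show ?thesis .
qed

locale perturbed_bvp =
  linear_bvp A \<Phi> K \<Gamma> B + f: nonlinearity f sf x0 + g: nonlinearity g sg x0
  for A \<Phi> :: "real \<Rightarrow> real^'n^'n" and K and \<Gamma> :: "(real \<Rightarrow> real^'n) \<Rightarrow> real^'n" and B
    and f g :: "real \<times> (real^'n) \<Rightarrow> real^'n" and sf sg and x0
begin

text \<open>The argument is a function on the whole line, but only its values at nonnegative times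
  enter.\<close>

definition N :: "(real \<Rightarrow>\<^sub>C (real^'n)) \<Rightarrow> real^'n" where
  "N X = defect (\<lambda>t. g (t, X t)) (\<lambda>t. f (t, X t))"

definition L :: "(real \<Rightarrow>\<^sub>C (real^'n)) \<Rightarrow> real^'n" where
  "L X = defect (\<lambda>t. g.J t *v X t) (\<lambda>t. f.J t *v X t)"

definition D :: "(real \<Rightarrow>\<^sub>C (real^'n)) \<Rightarrow> (real \<Rightarrow>\<^sub>C (real^'n))" where
  "D X = bc_ext (duhamel \<Phi> (\<lambda>s. f (s, X s)))"

definition E :: "real^'n \<Rightarrow> (real \<Rightarrow>\<^sub>C (real^'n))" where
  "E w = bc_ext (\<lambda>t. \<Phi> t *v w)"

definition X0 :: "real \<Rightarrow>\<^sub>C (real^'n)" where "X0 = bc_ext x0"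

lemma near_X0:
  assumes "X \<in> cball X0 \<delta>" "t \<ge> 0"
  shows "norm (X t - x0 t) \<le> \<delta>"
proof -
  have "norm (X t - X0 t) \<le> dist X X0" using dist_bounded[of X t X0] by (simp add: dist_norm)
  then show ?thesis
    using assms by (simp add: X0_def apply_bc_ext[OF f.x0] dist_commute)
qed

lemma norm_diff_apply: "norm (X t - X' t) \<le> norm (X - X')"
  for X X' :: "real \<Rightarrow>\<^sub>C (real^'n)"
  using norm_bounded[of "X - X'" t] by simp

lemma E_apply: "E w t = \<Phi> (max t 0) *v w"
  unfolding E_def by (rule apply_bc_ext[OF Phi_BC])

lemma E_bounded_linear: "bounded_linear E"
proof (rule bounded_linear_intro[where K = K])
  show "E (v + w) = E v + E w" for v w
    by (rule bcontfun_eqI) (simp add: E_apply matrix_vector_right_distrib)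
  show "E (c *\<^sub>R w) = c *\<^sub>R E w" for c w
    by (rule bcontfun_eqI) (simp add: E_apply matrix_vector_mult_scaleR)
  show "norm (E w) \<le> norm w * K" for w
    unfolding E_def using Phi_norm[of _ w] by (intro norm_bc_ext_le Phi_BC) (simp add: mult.commute)
qed

lemma ev_bounded_linear: "bounded_linear (\<lambda>X :: real \<Rightarrow>\<^sub>C (real^'n). X 0)"
  by (rule bounded_linear_intro[where K = 1]) (auto simp: norm_bounded)

lemma L_bounded_linear: "bounded_linear L"
proof -
  obtain Cg where Cg: "Cg \<ge> 0" "\<forall>x b. continuous_on {0..} x \<longrightarrow> (\<forall>t\<ge>0. norm (x t) \<le> b)
        \<longrightarrow> (\<lambda>t. g.J t *v x t) \<in> L1C \<and> L1_norm (\<lambda>t. g.J t *v x t) \<le> Cg * b"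
    using g.J_mult by blast
  obtain Cf where Cf: "Cf \<ge> 0" "\<forall>x b. continuous_on {0..} x \<longrightarrow> (\<forall>t\<ge>0. norm (x t) \<le> b)
        \<longrightarrow> (\<lambda>t. f.J t *v x t) \<in> L1C \<and> L1_norm (\<lambda>t. f.J t *v x t) \<le> Cf * b"
    using f.J_mult by blast
  note L1C = g.J_BC[OF bcontfun_BC] f.J_BC[OF bcontfun_BC]
  show ?thesis
  proof (rule bounded_linear_intro[where K = "Cg + B * K * Cf"])
    show "L (X + Y) = L X + L Y" for X Y
      unfolding L_def plus_bcontfun.rep_eq matrix_vector_right_distrib by (rule defect_add[OF L1C L1C])
    show "L (c *\<^sub>R X) = c *\<^sub>R L X" for c X
      unfolding L_def scaleR_bcontfun.rep_eq matrix_vector_mult_scaleR by (rule defect_scaleR[OF L1C])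
    fix X :: "real \<Rightarrow>\<^sub>C (real^'n)"
    have "norm (L X) \<le> L1_norm (\<lambda>t. g.J t *v X t) + B * K * L1_norm (\<lambda>t. f.J t *v X t)"
      unfolding L_def by (rule defect_norm[OF L1C])
    also have "\<dots> \<le> Cg * norm X + B * K * (Cf * norm X)"
      using Cg(2)[rule_format, of X "norm X"] Cf(2)[rule_format, of X "norm X"] B K_nonneg
      by (intro add_mono mult_left_mono) (auto simp: norm_bounded)
    finally show "norm (L X) \<le> norm X * (Cg + B * K * Cf)" by (simp add: algebra_simps)
  qed
qed

lemma N_strict_derivative:
  assumes "e > 0"
  shows "\<exists>\<delta>>0. \<forall>X\<in>cball X0 \<delta>. \<forall>X'\<in>cball X0 \<delta>. norm (N X - N X' - L (X - X')) \<le> e * norm (X - X')"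
proof -
  \<comment> \<open>The boundary integrand enters the defect directly, the forcing through Duhamel's
    operator (\<open>K\<close>) and \<Gamma> (\<open>B\<close>); the remainder is then at most
    \<open>c * \<delta>\<close> times the distance.\<close>
  define c where "c = integral {0..} (\<lambda>t. \<bar>sg t\<bar>) + B * K * integral {0..} (\<lambda>t. \<bar>sf t\<bar>)"
  have c: "c \<ge> 0"
    unfolding c_def using B K_nonneg f.abs_s_int g.abs_s_int
    by (intro add_nonneg_nonneg mult_nonneg_nonneg integral_nonneg)
      (auto simp: absolutely_integrable_on_def)
  define \<delta> where "\<delta> = e / (c + 1)"
  have \<delta>: "\<delta> > 0" "c * \<delta> \<le> e"
    using assms c by (auto simp: \<delta>_def field_simps)
  have "norm (N X - N X' - L (X - X')) \<le> e * norm (X - X')"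
    if X: "X \<in> cball X0 \<delta>" "X' \<in> cball X0 \<delta>" for X X'
  proof -
    let ?d = "norm (X - X')"
    note L1C = g.comp_L1C[OF bcontfun_BC] f.comp_L1C[OF bcontfun_BC]
    note L1C' = g.J_BC[OF BC_diff[OF bcontfun_BC bcontfun_BC]] f.J_BC[OF BC_diff[OF bcontfun_BC bcontfun_BC]]
    note R = g.remainder[OF bcontfun_BC bcontfun_BC near_X0[OF X(1)] near_X0[OF X(2)] norm_diff_apply]
    note R' = f.remainder[OF bcontfun_BC bcontfun_BC near_X0[OF X(1)] near_X0[OF X(2)] norm_diff_apply]
    have "N X - N X' = defect (\<lambda>t. g (t, X t) - g (t, X' t)) (\<lambda>t. f (t, X t) - f (t, X' t))"
      unfolding N_def by (rule defect_diff[OF L1C L1C, symmetric])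
    moreover have "L (X - X') = defect (\<lambda>t. g.J t *v (X t - X' t)) (\<lambda>t. f.J t *v (X t - X' t))"
      by (simp add: L_def)
    ultimately have eq: "N X - N X' - L (X - X')
        = defect (\<lambda>t. g (t, X t) - g (t, X' t) - g.J t *v (X t - X' t))
                 (\<lambda>t. f (t, X t) - f (t, X' t) - f.J t *v (X t - X' t))"
      by (simp only: defect_diff[OF L1C_diff[OF L1C(1) L1C(1)] L1C_diff[OF L1C(2) L1C(2)] L1C'])
    have "norm (N X - N X' - L (X - X')) \<le> integral {0..} (\<lambda>t. \<bar>sg t\<bar>) * \<delta> * ?d
        + B * K * (integral {0..} (\<lambda>t. \<bar>sf t\<bar>) * \<delta> * ?d)"
      unfolding eq
      by (rule order_trans[OF defect_norm[OF R(1) R'(1)] add_mono[OF R(2) mult_left_mono[OF R'(2)]]])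
        (use B K_nonneg in auto)
    also have "\<dots> = c * \<delta> * ?d" by (simp add: c_def algebra_simps)
    also have "\<dots> \<le> e * ?d" using \<delta> by (intro mult_right_mono) auto
    finally show ?thesis .
  qed
  with \<delta> show ?thesis by blast
qed

lemma D_lipschitz:
  "\<exists>C. \<forall>X\<in>cball X0 1. \<forall>X'\<in>cball X0 1. norm (D X - D X') \<le> C * norm (X - X')"
proof -
  obtain C where C: "\<forall>x\<in>BC. \<forall>x'\<in>BC. \<forall>d. (\<forall>t\<ge>0. norm (x t - x0 t) \<le> 1 \<and> norm (x' t - x0 t) \<le> 1
        \<and> norm (x t - x' t) \<le> d)
      \<longrightarrow> L1_norm (\<lambda>t. f (t, x t) - f (t, x' t)) \<le> C * d"
    using f.lipschitz by blast
  show ?thesis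
  proof (intro exI ballI)
    fix X X' assume X: "X \<in> cball X0 1" "X' \<in> cball X0 1"
    note L1C = f.comp_L1C[OF bcontfun_BC]
    have lip: "L1_norm (\<lambda>t. f (t, X t) - f (t, X' t)) \<le> C * norm (X - X')"
      using C[rule_format, OF bcontfun_BC bcontfun_BC, of X X' "norm (X - X')"]
        near_X0[OF X(1)] near_X0[OF X(2)] norm_diff_apply by blast
    have diff: "duhamel \<Phi> (\<lambda>t. f (t, X t) - f (t, X' t)) t
        = duhamel \<Phi> (\<lambda>s. f (s, X s)) t - duhamel \<Phi> (\<lambda>s. f (s, X' s)) t" for t
      using duhamel_add[OF L1C L1C_scaleR[OF L1C], of X "-1" X' t]
        duhamel_scaleR[of "-1" "\<lambda>s. f (s, X' s)" t] by simp
    have eq: "D X - D X' = bc_ext (duhamel \<Phi> (\<lambda>t. f (t, X t) - f (t, X' t)))"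
      unfolding D_def bc_ext_diff[OF duhamel_BC[OF L1C] duhamel_BC[OF L1C], symmetric]
      by (simp add: diff[symmetric])
    have "norm (D X - D X') \<le> K * L1_norm (\<lambda>t. f (t, X t) - f (t, X' t))"
      unfolding eq by (intro norm_bc_ext_le duhamel_BC duhamel_norm L1C_diff L1C)
    also have "\<dots> \<le> K * (C * norm (X - X'))"
      using lip K_nonneg by (rule mult_left_mono)
    finally show "norm (D X - D X') \<le> (K * C) * norm (X - X')" by (simp add: mult.assoc)
  qed
qed

text \<open>Along homogeneous solutions the derivative of \<open>N\<close> is the bracket in the
  definition of \<phi>, so the abstract bijectivity condition becomes the stated one.\<close>

lemma L_E: "L (E w) = (integral {0..} (\<lambda>t. g.J t ** \<Phi> t)
    - columnwise \<Gamma> (duhamel_matrix \<Phi> (\<lambda>t. f.J t ** \<Phi> t))) *v w"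
proof -
  have M: "norm (\<Phi> t) \<le> (real CARD('n))\<^sup>2 * K" if "t \<ge> 0" for t
    using norm_le_op_norm[of "\<Phi> t"] Phi_op_norm[OF that]
    by (meson mult_left_mono order_trans zero_le_power2)
  have "(\<lambda>t. (f.J t ** \<Phi> t) *v w) \<in> L1C" for w
    using f.J_BC[OF Phi_BC[of w]] by (simp add: matrix_vector_mul_assoc)
  from defect_matrix[OF g.J_matrix_L1C[OF Phi_cont M] f.J_matrix_L1C[OF Phi_cont M] this]
  have *: "(integral {0..} (\<lambda>t. g.J t ** \<Phi> t)
    - columnwise \<Gamma> (duhamel_matrix \<Phi> (\<lambda>t. f.J t ** \<Phi> t))) *v w
    = defect (\<lambda>t. g.J t *v (\<Phi> t *v w)) (\<lambda>t. f.J t *v (\<Phi> t *v w))"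
    by (simp add: matrix_vector_mul_assoc)
  have "integral {0..} (\<lambda>t. g.J t *v E w t) = integral {0..} (\<lambda>t. g.J t *v (\<Phi> t *v w))"
    by (intro integral_cong) (simp add: E_apply)
  \<comment> \<open>\<open>E w\<close> is constant at negative times, so agreement with
    \<open>\<Phi> t *v w\<close> is available only on the half line and congruence of \<Gamma> is
    needed.\<close>
  moreover have "\<Gamma> (duhamel \<Phi> (\<lambda>t. f.J t *v E w t)) = \<Gamma> (duhamel \<Phi> (\<lambda>t. f.J t *v (\<Phi> t *v w)))"
  proof (rule cong[OF duhamel_BC[OF f.J_BC[OF bcontfun_BC]]])
    fix t :: real assume "t \<ge> 0"
    show "duhamel \<Phi> (\<lambda>t. f.J t *v E w t) t = duhamel \<Phi> (\<lambda>t. f.J t *v (\<Phi> t *v w)) t"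
      unfolding duhamel_def
      by (intro arg_cong[where f = "(*v) (\<Phi> t)"] integral_cong) (simp add: E_apply)
  qed
  ultimately show ?thesis unfolding * L_def by (simp add: defect_def)
qed

text \<open>\<open>x0\<close> carries \<open>h\<close> and \<open>u\<close>,
  \<open>\<Phi> t *v z\<close> is homogeneous, and the Duhamel term produces the forcing. In the
  boundary condition the Duhamel contribution cancels against the \<Gamma>-term of the defect,
  leaving exactly the integral of \<open>g\<close>.\<close>

lemma solution_of_fixed_point:
  assumes h: "solves_bvp A \<Gamma> h u x0"
    and x: "x \<in> BC" and eq: "\<And>t. t \<ge> 0 \<Longrightarrow> x t = x0 t + \<Phi> t *v z + \<epsilon> *\<^sub>R duhamel \<Phi> (\<lambda>s. f (s, x s)) t"
    and z: "columnwise \<Gamma> \<Phi> *v z = \<epsilon> *\<^sub>R defect (\<lambda>t. g (t, x t)) (\<lambda>t. f (t, x t))"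
  shows "solves_bvp A \<Gamma> (\<lambda>t. h t + \<epsilon> *\<^sub>R f (t, x t)) (u + \<epsilon> *\<^sub>R integral {0..} (\<lambda>t. g (t, x t))) x"
  unfolding solves_bvp_def
proof (intro conjI allI impI)
  let ?d = "duhamel \<Phi> (\<lambda>s. f (s, x s))"
  have f: "(\<lambda>s. f (s, x s)) \<in> L1C" by (rule f.comp_L1C[OF x])
  show "x \<in> BC" by (rule x)
  show "\<exists>x'. (x has_vector_derivative x') (at t within {0..}) \<and> x' - A t *v x t = h t + \<epsilon> *\<^sub>R f (t, x t)"
    if t: "t \<ge> 0" for t
  proof -
    obtain x0' where x0': "(x0 has_vector_derivative x0') (at t within {0..})" "x0' - A t *v x0 t = h t"
      using h t by (auto simp: solves_bvp_def)
    have "((\<lambda>t. x0 t + \<Phi> t *v z + \<epsilon> *\<^sub>R ?d t) has_vector_derivative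
        (x0' + A t *v (\<Phi> t *v z) + \<epsilon> *\<^sub>R (A t *v ?d t + f (t, x t)))) (at t within {0..})"
      by (intro has_vector_derivative_add x0' Phi_vector_deriv[OF t]
          bounded_linear.has_vector_derivative[OF bounded_linear_scaleR_right] duhamel_deriv L1C_D(1)[OF f] t)
    then have "(x has_vector_derivative
        (x0' + A t *v (\<Phi> t *v z) + \<epsilon> *\<^sub>R (A t *v ?d t + f (t, x t)))) (at t within {0..})"
      by (rule has_vector_derivative_transform[rotated 2]) (use eq t in auto)
    moreover have "x0' + A t *v (\<Phi> t *v z) + \<epsilon> *\<^sub>R (A t *v ?d t + f (t, x t)) - A t *v x t = h t + \<epsilon> *\<^sub>R f (t, x t)"
      unfolding eq[OF t] x0'(2)[symmetric]
      by (simp add: matrix_vector_right_distrib matrix_vector_mult_scaleR algebra_simps)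
    ultimately show ?thesis by blast
  qed
  have "\<Gamma> x = \<Gamma> (\<lambda>t. x0 t + \<Phi> t *v z + \<epsilon> *\<^sub>R ?d t)"
    by (rule cong[OF x]) (rule eq)
  also have "\<dots> = \<Gamma> x0 + \<Gamma> (\<lambda>t. \<Phi> t *v z) + \<epsilon> *\<^sub>R \<Gamma> ?d"
    using f.x0 Phi_BC[of z] duhamel_BC[OF f]
    by (simp add: add scaleR BC_add BC_scaleR)
  also have "\<dots> = u + \<epsilon> *\<^sub>R integral {0..} (\<lambda>t. g (t, x t))"
    using h z by (simp add: solves_bvp_def columnwise_Phi[symmetric] defect_def scaleR_diff_right)
  finally show "\<Gamma> x = u + \<epsilon> *\<^sub>R integral {0..} (\<lambda>t. g (t, x t))" .
qed

theorem perturbed_solutions: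
  fixes W :: "real^'p^'n"
  assumes h: "solves_bvp A \<Gamma> h u x0"
    and W: "span (columns W) = matrix_ker (transpose (columnwise \<Gamma> \<Phi>))"
    and zero: "transpose W *v defect (\<lambda>t. g (t, x0 t)) (\<lambda>t. f (t, x0 t)) = 0"
    and bij: "bij_betw
      (\<lambda>w. transpose W *v ((integral {0..} (\<lambda>t. g.J t ** \<Phi> t)
         - columnwise \<Gamma> (duhamel_matrix \<Phi> (\<lambda>t. f.J t ** \<Phi> t))) *v w))
      (matrix_ker (columnwise \<Gamma> \<Phi>)) UNIV"
  obtains \<epsilon>0 and x :: "real \<Rightarrow> real \<Rightarrow> real^'n" where "\<epsilon>0 > 0"
    "\<And>\<epsilon>. \<bar>\<epsilon>\<bar> \<le> \<epsilon>0 \<Longrightarrow> solves_bvp A \<Gamma> (\<lambda>t. h t + \<epsilon> *\<^sub>R f (t, x \<epsilon> t))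
       (u + \<epsilon> *\<^sub>R integral {0..} (\<lambda>t. g (t, x \<epsilon> t))) (x \<epsilon>)"
    "((\<lambda>\<epsilon>. sup_norm (\<lambda>t. x \<epsilon> t - x0 t)) \<longlongrightarrow> 0) (at 0)"
proof -
  have X0: "X0 t = x0 t" if "t \<ge> 0" for t using that by (simp add: X0_def apply_bc_ext f.x0)
  have DX: "D X t = duhamel \<Phi> (\<lambda>s. f (s, X s)) t" if "t \<ge> 0" for X t
    using that by (simp add: D_def apply_bc_ext duhamel_BC[OF f.comp_L1C[OF bcontfun_BC]])
  have EX: "E w t = \<Phi> t *v w" if "t \<ge> 0" for w t
    using that by (simp add: E_apply)
  have "integral {0..} (\<lambda>t. g (t, X0 t)) = integral {0..} (\<lambda>t. g (t, x0 t))"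
    by (intro integral_cong) (simp add: X0)
  moreover have "\<Gamma> (duhamel \<Phi> (\<lambda>t. f (t, X0 t))) = \<Gamma> (duhamel \<Phi> (\<lambda>t. f (t, x0 t)))"
  proof (rule cong[OF duhamel_BC[OF f.comp_L1C[OF bcontfun_BC]]])
    show "duhamel \<Phi> (\<lambda>t. f (t, X0 t)) t = duhamel \<Phi> (\<lambda>t. f (t, x0 t)) t" for t
      unfolding duhamel_def
      by (intro arg_cong[where f = "(*v) (\<Phi> t)"] integral_cong) (simp add: X0)
  qed
  ultimately have zero': "transpose W *v N X0 = 0"
    using zero by (simp add: N_def defect_def)
  obtain C where C: "\<And>X X'. \<lbrakk>X \<in> cball X0 1; X' \<in> cball X0 1\<rbrakk> \<Longrightarrow> norm (D X - D X') \<le> C * norm (X - X')"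
    using D_lipschitz by blast
  have ev_E: "E w 0 = w" for w by (simp add: EX Phi_0)
  have ev_D: "D X 0 = 0" for X by (simp add: DX duhamel_0)
  have bij': "bij_betw (\<lambda>w. transpose W *v L (E w)) {w. columnwise \<Gamma> \<Phi> *v w = 0} UNIV"
    using bij by (simp add: L_E matrix_ker_def)
  obtain \<epsilon>0 X where \<epsilon>0: "\<epsilon>0 > 0"
    and X: "\<And>\<epsilon>. \<bar>\<epsilon>\<bar> \<le> \<epsilon>0 \<Longrightarrow> \<exists>z. X \<epsilon> = X0 + E z + \<epsilon> *\<^sub>R D (X \<epsilon>) \<and> columnwise \<Gamma> \<Phi> *v z = \<epsilon> *\<^sub>R N (X \<epsilon>)"
    and lim: "(X \<longlongrightarrow> X0) (at 0)"
    using lyapunov_schmidt[where J = E and ev = "\<lambda>X. apply_bcontfun X 0" and L = L and N = N and D = D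
        and Lam = "(*v) (columnwise \<Gamma> \<Phi>)" and W = "(*v) (transpose W)" and r = 1, OF E_bounded_linear ev_bounded_linear L_bounded_linear
        matrix_vector_mul_linear matrix_vector_mul_linear ev_E ev_D
        range_eq_kernel_transpose[OF W] zero' N_strict_derivative zero_less_one C bij']
    by blast
  show ?thesis
  proof (rule that[of \<epsilon>0 "\<lambda>\<epsilon>. apply_bcontfun (X \<epsilon>)"])
    show "\<epsilon>0 > 0" by fact
    fix \<epsilon> :: real assume "\<bar>\<epsilon>\<bar> \<le> \<epsilon>0"
    then obtain z where z: "X \<epsilon> = X0 + E z + \<epsilon> *\<^sub>R D (X \<epsilon>)" "columnwise \<Gamma> \<Phi> *v z = \<epsilon> *\<^sub>R N (X \<epsilon>)"
      using X by blast
    have "X \<epsilon> t = x0 t + \<Phi> t *v z + \<epsilon> *\<^sub>R duhamel \<Phi> (\<lambda>s. f (s, X \<epsilon> s)) t" if "t \<ge> 0" for t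
      using arg_cong[OF z(1), of "\<lambda>Y. apply_bcontfun Y t"] that by (simp add: X0 EX DX)
    then show "solves_bvp A \<Gamma> (\<lambda>t. h t + \<epsilon> *\<^sub>R f (t, X \<epsilon> t))
       (u + \<epsilon> *\<^sub>R integral {0..} (\<lambda>t. g (t, X \<epsilon> t))) (X \<epsilon>)"
      using z(2) by (intro solution_of_fixed_point[OF h bcontfun_BC]) (auto simp: N_def)
  next
    have "sup_norm (\<lambda>t. X \<epsilon> t - x0 t) \<le> norm (X \<epsilon> - X0)" for \<epsilon>
      using norm_diff_apply[of "X \<epsilon>" _ X0] by (intro sup_norm_le) (metis X0)
    moreover have "0 \<le> sup_norm (\<lambda>t. X \<epsilon> t - x0 t)" for \<epsilon>
      by (intro sup_norm_nonneg BC_diff bcontfun_BC f.x0)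
    ultimately have "\<forall>\<^sub>F \<epsilon> in at 0. norm (sup_norm (\<lambda>t. X \<epsilon> t - x0 t)) \<le> norm (X \<epsilon> - X0)"
      by simp
    moreover have "((\<lambda>\<epsilon>. norm (X \<epsilon> - X0)) \<longlongrightarrow> 0) (at 0)"
      using lim by (simp add: LIM_zero tendsto_norm_zero)
    ultimately show "((\<lambda>\<epsilon>. sup_norm (\<lambda>t. X \<epsilon> t - x0 t)) \<longlongrightarrow> 0) (at 0)"
      by (rule Lim_null_comparison)
  qed
qed

end

text \<open>A homogeneous solution with initial value in the kernel changes neither forcing nor
  boundary data; this turns the particular solution with initial value \<open>v\<close> into the
  base point \<open>xy\<close>.\<close>

lemma (in linear_bvp) solves_bvp_add_kernel:
  assumes x: "solves_bvp A \<Gamma> h u x" and y: "columnwise \<Gamma> \<Phi> *v y = 0"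
  shows "solves_bvp A \<Gamma> h u (\<lambda>t. x t + \<Phi> t *v y)"
  unfolding solves_bvp_def
proof (intro conjI allI impI)
  have BC: "x \<in> BC" using x by (simp add: solves_bvp_def)
  show "(\<lambda>t. x t + \<Phi> t *v y) \<in> BC" by (intro BC_add BC Phi_BC)
  show "\<Gamma> (\<lambda>t. x t + \<Phi> t *v y) = u"
    using add[OF BC Phi_BC] x y by (simp add: solves_bvp_def columnwise_Phi)
  fix t :: real assume t: "t \<ge> 0"
  then obtain x' where x': "(x has_vector_derivative x') (at t within {0..})" "x' - A t *v x t = h t"
    using x by (auto simp: solves_bvp_def)
  have "((\<lambda>t. x t + \<Phi> t *v y) has_vector_derivative x' + A t *v (\<Phi> t *v y)) (at t within {0..})"
    by (intro has_vector_derivative_add x' Phi_vector_deriv t)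
  moreover have "x' + A t *v (\<Phi> t *v y) - A t *v (x t + \<Phi> t *v y) = h t"
    using x'(2) by (simp add: matrix_vector_right_distrib)
  ultimately show "\<exists>d. ((\<lambda>t. x t + \<Phi> t *v y) has_vector_derivative d) (at t within {0..})
      \<and> d - A t *v (x t + \<Phi> t *v y) = h t"
    by blast
qed

theorem theorem2:
  fixes A :: "real \<Rightarrow> real^'n^'n"
    and h :: "real \<Rightarrow> real^'n"
    and u :: "real^'n"
    and f g :: "real \<times> (real^'n) \<Rightarrow> real^'n"
    and \<Gamma> :: "(real \<Rightarrow> real^'n) \<Rightarrow> real^'n"
    and \<Phi> :: "real \<Rightarrow> real^'n^'n"
    and \<Lambda> :: "real^'n^'n"
    and W :: "real^'p^'n"
    and v y :: "real^'n"
    and xy :: "real \<Rightarrow> real^'n"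
  assumes A_cont: "continuous_on {0..} A"
    and h_BC: "h \<in> BC"
    and h_L1: "h absolutely_integrable_on {0..}"
    and f_C1: "C1_map f"
    and g_C1: "C1_map g"
    and Gamma: "bounded_linear_BC \<Gamma>"
    and Phi: "fundamental_matrix A \<Phi>"
    and Lambda: "\<Lambda> = columnwise \<Gamma> \<Phi>"
    and singular: "\<not> invertible \<Lambda>"
    and p: "CARD('p) = dim (matrix_ker \<Lambda>)"
    and W_inj: "inj (\<lambda>j. column j W)"
    and W_indep: "independent (columns W)"
    and W_span: "span (columns W) = matrix_ker (transpose \<Lambda>)"
    and linear_solvable: "solves_bvp A \<Gamma> h u (linear_trajectory \<Phi> h v)"
    and H1: "\<exists>K>0. \<forall>t s. 0 \<le> s \<and> s \<le> t \<longrightarrow> op_norm (\<Phi> t ** matrix_inv (\<Phi> s)) \<le> K"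
    and H2_unif: "uniformly_continuous_on ({0..} \<times> UNIV) (\<lambda>(t, x). jac_x g t x)"
    and H2_int: "(\<lambda>t. op_norm (jac_x g t 0)) absolutely_integrable_on {0..}"
    and H3: "\<forall>\<eta>\<in>BC. (\<lambda>t. norm (g (t, \<eta> t))) absolutely_integrable_on {0..}"
    and H4_unif: "uniformly_continuous_on ({0..} \<times> UNIV) (\<lambda>(t, x). jac_x f t x)"
    and H4_int: "(\<lambda>t. op_norm (jac_x f t 0)) absolutely_integrable_on {0..}"
    and H5: "\<exists>s :: real \<Rightarrow> real. s absolutely_integrable_on {0..} \<and>
               (\<forall>t\<ge>0. \<forall>x1 x2. op_norm (jac_x g t x1 - jac_x g t x2) \<le> s t * norm (x1 - x2))"
    and H6: "\<exists>h1 :: real \<Rightarrow> real. h1 absolutely_integrable_on {0..} \<and>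
               (\<forall>S :: (real^'n) set. compact S \<longrightarrow>
                  (\<exists>C. \<forall>t\<ge>0. \<forall>x\<in>S. norm (f (t, x)) \<le> C * h1 t) \<and>
                  (\<forall>t\<ge>0. \<forall>x1\<in>S. \<forall>x2\<in>S. norm (f (t, x1) - f (t, x2)) \<le> h1 t * norm (x1 - x2)))"
    and H7: "\<exists>h2 :: real \<Rightarrow> real. h2 absolutely_integrable_on {0..} \<and>
               (\<forall>S :: (real^'n) set. compact S \<longrightarrow>
                  (\<forall>t\<ge>0. \<forall>x1\<in>S. \<forall>x2\<in>S.
                     op_norm (jac_x f t x1 - jac_x f t x2) \<le> h2 t * norm (x1 - x2)))"
    and y_ker: "y \<in> matrix_ker \<Lambda>"
    and xy: "xy = linear_trajectory \<Phi> h (v + y)"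
    and bifurcation:
      "transpose W *v
         (integral {0..} (\<lambda>t. g (t, xy t)) - \<Gamma> (duhamel \<Phi> (\<lambda>s. f (s, xy s)))) = 0"
    and phi_bij:
      "bij_betw
         (\<lambda>w. (transpose W **
                (integral {0..} (\<lambda>t. jac_x g t (xy t) ** \<Phi> t)
                 - columnwise \<Gamma> (duhamel_matrix \<Phi> (\<lambda>s. jac_x f s (xy s) ** \<Phi> s)))) *v w)
         (matrix_ker \<Lambda>) (UNIV :: (real^'p) set)"
  shows "\<exists>\<epsilon>0>0. \<exists>x\<epsilon> :: real \<Rightarrow> real \<Rightarrow> real^'n.
           (\<forall>\<epsilon>. \<bar>\<epsilon>\<bar> \<le> \<epsilon>0 \<longrightarrow>
              solves_bvp A \<Gamma>
                (\<lambda>t. h t + \<epsilon> *\<^sub>R f (t, x\<epsilon> \<epsilon> t))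
                (u + \<epsilon> *\<^sub>R integral {0..} (\<lambda>t. g (t, x\<epsilon> \<epsilon> t)))
                (x\<epsilon> \<epsilon>)) \<and>
           ((\<lambda>\<epsilon>. sup_norm (\<lambda>t. x\<epsilon> \<epsilon> t - xy t)) \<longlongrightarrow> 0) (at 0)"
proof -
  obtain K where "\<And>s t. \<lbrakk>0 \<le> s; s \<le> t\<rbrakk> \<Longrightarrow> op_norm (\<Phi> t ** matrix_inv (\<Phi> s)) \<le> K"
    using H1 by blast
  then interpret bounded_fundamental A \<Phi> K
    using A_cont Phi by unfold_locales
  obtain B where "BC_functional \<Gamma> B" using BC_functional_exists[OF Gamma] .
  then interpret BC_functional \<Gamma> B .
  interpret linear_bvp A \<Phi> K \<Gamma> B ..
  have "xy = (\<lambda>t. linear_trajectory \<Phi> h v t + \<Phi> t *v y)"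
    unfolding xy by (simp add: fun_eq_iff linear_trajectory_def matrix_vector_right_distrib)
  moreover have "columnwise \<Gamma> \<Phi> *v y = 0"
    using y_ker by (simp add: Lambda matrix_ker_def)
  ultimately have sol: "solves_bvp A \<Gamma> h u xy"
    using solves_bvp_add_kernel[OF linear_solvable] by simp
  then have xy_BC: "xy \<in> BC" by (simp add: solves_bvp_def)
  obtain sg :: "real \<Rightarrow> real" where sg: "sg absolutely_integrable_on {0..}"
    "\<forall>t\<ge>0. \<forall>x1 x2. op_norm (jac_x g t x1 - jac_x g t x2) \<le> sg t * norm (x1 - x2)"
    using H5 by blast
  obtain h1 :: "real \<Rightarrow> real" where h1: "h1 absolutely_integrable_on {0..}"
    "\<forall>S :: (real^'n) set. compact S \<longrightarrow>
       (\<exists>C. \<forall>t\<ge>0. \<forall>x\<in>S. norm (f (t, x)) \<le> C * h1 t) \<and>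
       (\<forall>t\<ge>0. \<forall>x1\<in>S. \<forall>x2\<in>S. norm (f (t, x1) - f (t, x2)) \<le> h1 t * norm (x1 - x2))"
    using H6 by (elim exE conjE) (rule that)
  obtain h2 :: "real \<Rightarrow> real" where h2: "h2 absolutely_integrable_on {0..}"
    "\<forall>S :: (real^'n) set. compact S \<longrightarrow> (\<forall>t\<ge>0. \<forall>x1\<in>S. \<forall>x2\<in>S.
       op_norm (jac_x f t x1 - jac_x f t x2) \<le> h2 t * norm (x1 - x2))"
    using H7 by blast
  have f_L1C: "(\<lambda>t. f (t, x t)) \<in> L1C" if x: "x \<in> BC" for x
  proof -
    obtain b where b: "\<forall>t\<ge>0. norm (x t) \<le> b" using BC_D(2)[OF x] by blast
    \<comment> \<open>A bounded trajectory stays in a compact ball, on which a multiple of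
      \<open>h1\<close> dominates \<open>f\<close>.\<close>
    obtain C where "\<forall>t\<ge>0. \<forall>z\<in>cball 0 b. norm (f (t, z)) \<le> C * h1 t"
      using h1(2)[rule_format, OF compact_cball, of 0 b] by blast
    with b show ?thesis
      using h1(1) by (intro L1C_dominated(1)[where b = "\<lambda>t. C * h1 t"]
          C1_map_cont_comp[OF f_C1] BC_D(1)[OF x]) auto
  qed
  have g_L1C: "(\<lambda>t. g (t, x t)) \<in> L1C" if x: "x \<in> BC" for x
    using H3 x by (intro L1C_dominated(1)[where b = "\<lambda>t. norm (g (t, x t))"]
        C1_map_cont_comp[OF g_C1] BC_D(1)[OF x]) auto
  interpret f: nonlinearity f h2 xy
  proof
    show "op_norm (jac_x f t x1 - jac_x f t x2) \<le> h2 t * norm (x1 - x2)"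
      if "compact S" "t \<ge> 0" "x1 \<in> S" "x2 \<in> S" for S t x1 x2
      using h2(2) that by blast
  qed (fact f_C1 H4_unif H4_int h2(1) f_L1C xy_BC)+
  interpret g: nonlinearity g sg xy
  proof
    show "op_norm (jac_x g t x1 - jac_x g t x2) \<le> sg t * norm (x1 - x2)" if "t \<ge> 0" for t x1 x2
      using sg(2) that by blast
  qed (fact g_C1 H2_unif H2_int sg(1) g_L1C xy_BC)+
  interpret perturbed_bvp A \<Phi> K \<Gamma> B f g h2 sg xy ..
  have zero: "transpose W *v defect (\<lambda>t. g (t, xy t)) (\<lambda>t. f (t, xy t)) = 0"
    using bifurcation by (simp add: defect_def)
  have bij: "bij_betw
      (\<lambda>w. transpose W *v ((integral {0..} (\<lambda>t. g.J t ** \<Phi> t)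
         - columnwise \<Gamma> (duhamel_matrix \<Phi> (\<lambda>t. f.J t ** \<Phi> t))) *v w))
      (matrix_ker (columnwise \<Gamma> \<Phi>)) UNIV"
    using phi_bij by (simp add: f.J_def g.J_def matrix_vector_mul_assoc Lambda)
  show ?thesis
    by (rule perturbed_solutions[OF sol W_span[unfolded Lambda] zero bij]) blast
qed

end
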